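(* Let $K \subset \mathbb{R}^{2}$ be compact and sub-uniformly distributed with $\dim_{\mathrm{H}} K = t \in (0,2)$. For $\max\{t-1,0\} < s \leq 1$ we have $$\mathfrak{h}(K,s) \leq \max\{t-s,0\}.$$ In particular, $\mathfrak{h}(K) \leq 1$.
   Context: $\dim_{\mathrm{H}}$ is Hausdorff dimension, with the convention $\dim_{\mathrm{H}} \emptyset = 0$. For $e \in S^{1}$ and $z \in \mathbb{R}^{2}$ write $\ell_{e,z} := z + \mathrm{span}(e)$. Heavy parts. Let $A \subset \mathbb{R}^{2}$. For $e \in S^{1}$ and $s > \max\{\dim_{\mathrm{H}} A - 1, 0\}$ let $$H(A,e,s) := \{z \in A : \dim_{\mathrm{H}}(A \cap \ell_{e,z}) \geq s\}, \qquad H(A,e) := \{z \in A : \dim_{\mathrm{H}}(A \cap \ell_{e,z}) > \max\{\dim_{\mathrm{H}} A - 1,0\}\}.$$ Then $$\mathfrak{h}(A,s) := \operatorname{ess\,sup}_{e \in S^{1}} \dim_{\mathrm{H}} H(A,e,s), \qquad \mathfrak{h}(A) := \operatorname{ess\,sup}_{e \in S^{1}} \dim_{\mathrm{H}} H(A,e),$$ where $\operatorname{ess\,sup}_{e} f(e)$ is the infimum of those $a$ such that $f(e) \leq a$ for $\mathcal{H}^{1}$ (arc-length) almost every $e \in S^{1}$. Sub-uniformly distributed sets. For a dyadic number $r \in 2^{\mathbb{Z}}$, let $\mathcal{D}_{r}(\mathbb{R}^{d})$ be the standard (half-open) dyadic cubes of side-length $r$; for $P \subset \mathbb{R}^{d}$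 let $\mathcal{D}_{r}(P) := \{Q \in \mathcal{D}_{r}(\mathbb{R}^{d}) : Q \cap P \neq \emptyset\}$ and let $|P|_{r} := |\mathcal{D}_{r}(P)|$ be the dyadic $r$-covering number. A bounded set $K \subset \mathbb{R}^{d}$ is sub-uniformly distributed if there exists a constant $C > 0$ such that $$|K|_{R} \cdot |K \cap Q|_{r} \leq C|K|_{r}, \qquad Q \in \mathcal{D}_{R}(K), \quad 0 < r \leq R < \infty.$$ *)

theory Defs
  imports "HOL-Analysis.Analysis"
begin

text \<open>Hausdorff measure, without normalising constant. The case distinction realises
  \<open>diam(U)^0 = 1\<close> for nonempty \<open>U\<close> (whereas \<open>0 powr 0 = 0\<close>) and \<open>diam({})^s = 0\<close>.\<close>

definition diam_pow :: "real \<Rightarrow> 'a::metric_space set \<Rightarrow> ennreal" where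
  "diam_pow s U = (if U = {} then 0 else if s = 0 then 1 else ennreal (diameter U powr s))"

text \<open>The condition \<open>bounded (U i)\<close> is needed because \<^const>\<open>diameter\<close> is real-valued and
  meaningless on unbounded sets. Finite covers are included, since \<open>U i\<close> may be empty.\<close>

definition delta_cover :: "real \<Rightarrow> 'a::metric_space set \<Rightarrow> (nat \<Rightarrow> 'a set) \<Rightarrow> bool" where
  "delta_cover \<delta> A U \<longleftrightarrow> A \<subseteq> (\<Union>i. U i) \<and> (\<forall>i. bounded (U i) \<and> diameter (U i) \<le> \<delta>)"

definition hausdorff_premeasure :: "real \<Rightarrow> real \<Rightarrow> 'a::metric_space set \<Rightarrow> ennreal" where
  "hausdorff_premeasure s \<delta> A = (INF U\<in>{U. delta_cover \<delta> A U}. \<Sum>i. diam_pow s (U i))"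

definition hausdorff_measure :: "real \<Rightarrow> 'a::metric_space set \<Rightarrow> ennreal" where
  "hausdorff_measure s A = (SUP \<delta>\<in>{0<..}. hausdorff_premeasure s \<delta> A)"

definition hausdorff_dim :: "'a::metric_space set \<Rightarrow> ereal" where
  "hausdorff_dim A = Inf {ereal s |s. 0 \<le> s \<and> hausdorff_measure s A = 0}"

lemma hausdorff_dim_empty: "hausdorff_dim ({} :: 'a::metric_space set) = 0"
proof (rule antisym)
  have "hausdorff_premeasure 0 \<delta> ({} :: 'a set) = 0" if "\<delta> > 0" for \<delta>
  proof -
    have "delta_cover \<delta> ({} :: 'a set) (\<lambda>_. {})"
      using that by (simp add: delta_cover_def)
    then have "hausdorff_premeasure 0 \<delta> ({} :: 'a set) \<le> (\<Sum>i. diam_pow 0 ({} :: 'a set))"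
      unfolding hausdorff_premeasure_def by (intro INF_lower2[where i = "\<lambda>_. {}"]) auto
    then show ?thesis
      by (simp add: diam_pow_def)
  qed
  then have "hausdorff_measure 0 ({} :: 'a set) = 0"
    unfolding hausdorff_measure_def by (simp add: SUP_eq_const)
  then show "hausdorff_dim ({} :: 'a set) \<le> 0"
    unfolding hausdorff_dim_def by (intro Inf_lower) (auto simp: zero_ereal_def)
  show "0 \<le> hausdorff_dim ({} :: 'a set)"
    unfolding hausdorff_dim_def by (intro Inf_greatest) auto
qed

definition line_through :: "real^2 \<Rightarrow> real^2 \<Rightarrow> (real^2) set" where
  "line_through e z = (\<lambda>v. z + v) ` span {e}"

text \<open>The essential supremum over the unit circle. The exceptional set need not be known to be
  measurable: null sets are taken with respect to the outer measure \<open>hausdorff_measure 1\<close>, which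
  is arc length on the circle. The library's \<open>esssup\<close> is unsuitable because it
  returns \<open>\<infinity>\<close> on nonmeasurable functions.\<close>

definition ess_sup_circle :: "(real^2 \<Rightarrow> ereal) \<Rightarrow> ereal" where
  "ess_sup_circle f = Inf {a. hausdorff_measure 1 {e \<in> sphere 0 1. \<not> f e \<le> a} = 0}"

definition heavy_part_at :: "(real^2) set \<Rightarrow> real^2 \<Rightarrow> real \<Rightarrow> (real^2) set" where
  "heavy_part_at A e s = {z \<in> A. hausdorff_dim (A \<inter> line_through e z) \<ge> ereal s}"

definition heavy_part :: "(real^2) set \<Rightarrow> real^2 \<Rightarrow> (real^2) set" where
  "heavy_part A e =
    {z \<in> A. hausdorff_dim (A \<inter> line_through e z) > max (hausdorff_dim A - 1) 0}"

definition heavy_dim_at :: "(real^2) set \<Rightarrow> real \<Rightarrow> ereal" where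
  "heavy_dim_at A s = ess_sup_circle (\<lambda>e. hausdorff_dim (heavy_part_at A e s))"

definition heavy_dim :: "(real^2) set \<Rightarrow> ereal" where
  "heavy_dim A = ess_sup_circle (\<lambda>e. hausdorff_dim (heavy_part A e))"

definition dyadic :: "real set" where
  "dyadic = range (\<lambda>k::int. 2 powi k)"

definition dyadic_cubes :: "real \<Rightarrow> (real^'d) set set" where
  "dyadic_cubes r =
    range (\<lambda>k :: 'd \<Rightarrow> int. {x. \<forall>i. r * of_int (k i) \<le> x $ i \<and> x $ i < r * (of_int (k i) + 1)})"

definition dyadic_cubes_meeting :: "real \<Rightarrow> (real^'d) set \<Rightarrow> (real^'d) set set" where
  "dyadic_cubes_meeting r P = {Q \<in> dyadic_cubes r. Q \<inter> P \<noteq> {}}"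

text \<open>Only meaningful for bounded \<open>P\<close> and \<open>r > 0\<close>, when finitely many cubes meet \<open>P\<close>.\<close>

definition covering_number :: "real \<Rightarrow> (real^'d) set \<Rightarrow> nat" where
  "covering_number r P = card (dyadic_cubes_meeting r P)"

definition sub_uniformly_distributed :: "(real^'d) set \<Rightarrow> bool" where
  "sub_uniformly_distributed K \<longleftrightarrow> bounded K \<and>
    (\<exists>C>0::real. \<forall>r\<in>dyadic. \<forall>R\<in>dyadic. r \<le> R \<longrightarrow>
      (\<forall>Q\<in>dyadic_cubes_meeting R K.
        real (covering_number R K) * real (covering_number r (K \<inter> Q))
          \<le> C * real (covering_number r K)))"

end

theory Submission
  imports Defs
begin

text \<open>Lines that are not too horizontal (after exchanging the coordinates if necessary) are the fibres of
the maps \<open>x \<mapsto> x $ i + a * x $ j\<close> with \<open>\<bar>a\<bar> \<le> 1\<close>, so directions are parametrised by slopes \<open>a\<close>. At a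
scale \<open>r\<close>, replace \<open>K\<close> by the uniform probability measure on the corners of the \<open>N\<^sub>r\<close> dyadic
\<open>r\<close>-cubes that meet it. The density of a tube of width
comparable to \<open>r\<close> is the mass that it carries divided by \<open>r\<close>.

Why the exponent is \<open>t - s\<close>. Let \<open>\<psi>\<close> be the difference of the averages over windows of radii \<open>5 r\<close> and
\<open>R = L r\<close>, with \<open>L\<close> a large constant. The squared \<open>L\<^sup>2\<close> norm of the projected measure convolved with
\<open>\<psi>\<close>, averaged over the slopes, is at most about \<open>1 / (r N\<^sub>r)\<close>, for every bounded set
(\<open>average_energy_bound\<close>). Indeed it is a sum over pairs of cubes, and because \<open>\<psi>\<close> has mean zero, the
contribution of a pair at distance \<open>d\<close> decays like \<open>(r/d)\<^sup>2\<close>, while the number of cubes at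
distance at most \<open>d\<close> from a given one is at most a multiple of \<open>(d/r)\<^sup>2\<close>: only a logarithm is lost.
By Chebyshev's inequality, the tubes of width \<open>r\<close> in a typical direction on which the convolution is
comparable to the density, the latter being at least \<open>\<tau>\<close>, meet at most about
\<open>N\<^sub>r/\<tau> * 1/(r N\<^sub>r) = 1/(r \<tau>)\<close> of the cubes of \<open>K\<close> (\<open>dense_cubes_le_energy\<close>). If \<open>K\<close> has about
\<open>r powr (-t)\<close> cubes and each tube contains at least \<open>r powr (-s)\<close> of them, then \<open>\<tau>\<close> is
\<open>r powr (t - s - 1)\<close> and the count is \<open>r powr (-(t - s))\<close>.

Why such a scale exists. If the slice through \<open>z\<close> has dimension \<open>s\<close> and \<open>K\<close> has at most about
\<open>\<delta> powr (-t)\<close> cubes at a small scale \<open>\<delta>\<close>, then the tube of width \<open>\<delta>\<close> around the slice has density at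
least about \<open>\<delta> powr (t - s - 1)\<close>. As \<open>s > t - 1\<close> this is large, whereas no tube of width \<open>r \<ge> 1\<close> has
density above \<open>1\<close>. Hence there is a largest scale \<open>r = \<delta> L ^ k\<close> at which the density exceeds
\<open>A * r powr (-2 \<epsilon>)\<close>, and at the next scale \<open>R = L r\<close> it has dropped by the factor \<open>L powr (-2 \<epsilon>)\<close>
(\<open>critical_scale\<close>). Sub-uniform distribution turns this into a statement about the measure of scale
\<open>r\<close>: its average over the wide window is less than half of its average over the narrow one
(\<open>tube_count_coarse\<close>), so the convolution with \<open>\<psi>\<close> is comparable to the density. Different points may have different
critical scales, which is harmless because a cover by cubes of several sizes is what Hausdorff
measure asks for.

It remains to sum the cost of these covers over the scales, and to apply a Borel--Cantelli argument
in \<open>a\<close> over \<open>\<delta> = (1/2) ^ n\<close>; the cover is used for those \<open>n\<close> at which \<open>K\<close> has few cubes. There are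
infinitely many of these, because for a compact sub-uniformly distributed set the lower box
dimension does not exceed the Hausdorff dimension (\<open>few_cubes_if_hausdorff_measure_zero\<close>).\<close>

section \<open>Null sets of Hausdorff measure\<close>

text \<open>For a positive exponent, the sets of a cover with a small sum automatically have small diameters.\<close>

lemma hausdorff_measure_zeroI:
  assumes s: "s > 0"
    and ex: "\<And>\<eta>. \<eta> > 0 \<Longrightarrow> \<exists>U :: nat \<Rightarrow> 'a::metric_space set. A \<subseteq> (\<Union>i. U i) \<and> (\<forall>i. bounded (U i)) \<and>
               (\<Sum>i. diam_pow s (U i)) \<le> ennreal \<eta>"
  shows "hausdorff_measure s A = 0"
proof -
  have "hausdorff_premeasure s \<delta> A = 0" if \<delta>: "\<delta> > 0" for \<delta>
  proof -
    have "hausdorff_premeasure s \<delta> A \<le> 0 + ennreal \<eta>" if \<eta>: "\<eta> > 0" for \<eta>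
    proof -
      define \<eta>' where "\<eta>' = min \<eta> (\<delta> powr s)"
      have "\<eta>' > 0" using \<eta> \<delta> by (simp add: \<eta>'_def)
      from ex[OF this] obtain U :: "nat \<Rightarrow> 'a set" where U: "A \<subseteq> (\<Union>i. U i)" "\<And>i. bounded (U i)"
        "(\<Sum>i. diam_pow s (U i)) \<le> ennreal \<eta>'" by blast
      have "diameter (U i) \<le> \<delta>" for i
      proof (cases "U i = {}")
        case True then show ?thesis using \<delta> by (simp add: diameter_def)
      next
        case False
        have "diam_pow s (U i) \<le> (\<Sum>i. diam_pow s (U i))"
          using sum_le_suminf[of "\<lambda>i. diam_pow s (U i)" "{i}"] by simp
        also have "\<dots> \<le> ennreal \<eta>'" by fact
        finally have "ennreal (diameter (U i) powr s) \<le> ennreal \<eta>'"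
          using False s by (simp add: diam_pow_def)
        then have "diameter (U i) powr s \<le> \<eta>'"
          using \<open>\<eta>' > 0\<close> by (simp add: ennreal_le_iff)
        then have "diameter (U i) powr s \<le> \<delta> powr s" by (simp add: \<eta>'_def)
        then show ?thesis
          using s \<delta> by (metis linorder_not_le powr_less_mono2 less_imp_le)
      qed
      then have "delta_cover \<delta> A U" using U by (auto simp: delta_cover_def)
      then have "hausdorff_premeasure s \<delta> A \<le> (\<Sum>i. diam_pow s (U i))"
        unfolding hausdorff_premeasure_def by (intro INF_lower) auto
      also have "\<dots> \<le> ennreal \<eta>" using U(3) 
        by (rule order_trans) (simp add: \<eta>'_def ennreal_leI)
      finally show ?thesis by simp
    qed
    then have "hausdorff_premeasure s \<delta> A \<le> 0"
      by (rule ennreal_le_epsilon)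
    then show ?thesis by simp
  qed
  then show ?thesis unfolding hausdorff_measure_def by (simp add: SUP_eq_const)
qed

lemma hausdorff_measure_zeroD:
  assumes "hausdorff_measure s A = 0" "\<delta> > 0" "\<eta> > 0"
  obtains U :: "nat \<Rightarrow> 'a::metric_space set" where "delta_cover \<delta> A U"
    "(\<Sum>i. diam_pow s (U i)) < ennreal \<eta>"
proof -
  have "hausdorff_premeasure s \<delta> A \<le> hausdorff_measure s A"
    unfolding hausdorff_measure_def using assms by (intro SUP_upper) auto
  then have "hausdorff_premeasure s \<delta> A < ennreal \<eta>" using assms by simp
  then show ?thesis unfolding hausdorff_premeasure_def INF_less_iff using that by auto
qed

lemma hausdorff_measure_zero_exponent_mono:
  fixes A :: "'a::metric_space set"
  assumes "hausdorff_measure s A = 0" "0 \<le> s" "s < s'"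
  shows "hausdorff_measure s' A = 0"
proof (rule hausdorff_measure_zeroI)
  show "s' > 0" using assms by simp
  fix \<eta> :: real assume "\<eta> > 0"
  then obtain U where U: "delta_cover 1 A U" "(\<Sum>i. diam_pow s (U i)) < ennreal \<eta>"
    using hausdorff_measure_zeroD[OF assms(1), of 1 \<eta>] by auto
  have "diam_pow s' (U i) \<le> diam_pow s (U i)" for i
  proof -
    have "diameter (U i) \<le> 1" "diameter (U i) \<ge> 0" using U(1)
      by (auto simp: delta_cover_def diameter_ge_0)
    then have "diameter (U i) powr s' \<le> diameter (U i) powr s" "diameter (U i) powr s' \<le> 1"
      using assms by (cases "diameter (U i) = 0"; auto intro: powr_mono' powr_le1)+
    then show ?thesis using assms by (auto simp: diam_pow_def ennreal_leI)
  qed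
  then have "(\<Sum>i. diam_pow s' (U i)) \<le> (\<Sum>i. diam_pow s (U i))"
    by (intro suminf_le) auto
  then show "\<exists>U. A \<subseteq> (\<Union>i. U i) \<and> (\<forall>i. bounded (U i)) \<and> (\<Sum>i. diam_pow s' (U i)) \<le> ennreal \<eta>"
    using U by (intro exI[of _ U]) (auto simp: delta_cover_def)
qed

lemma hausdorff_measure_zero_mono:
  assumes "hausdorff_measure s B = 0" "A \<subseteq> B"
  shows "hausdorff_measure s A = 0"
proof -
  have "hausdorff_premeasure s \<delta> A \<le> hausdorff_premeasure s \<delta> B" for \<delta>
    unfolding hausdorff_premeasure_def using assms(2)
    by (intro INF_superset_mono) (fastforce simp: delta_cover_def)+
  then have "hausdorff_measure s A \<le> hausdorff_measure s B"
    unfolding hausdorff_measure_def by (intro SUP_mono) auto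
  then show ?thesis using assms(1) by simp
qed

lemma hausdorff_measure_zero_UN:
  fixes A :: "nat \<Rightarrow> 'a::metric_space set"
  assumes s: "s > 0" and null: "\<And>m. hausdorff_measure s (A m) = 0"
  shows "hausdorff_measure s (\<Union>m. A m) = 0"
proof (rule hausdorff_measure_zeroI[OF s])
  fix \<eta> :: real assume \<eta>: "\<eta> > 0"
  have "\<exists>U. delta_cover 1 (A m) U \<and> (\<Sum>i. diam_pow s (U i)) < ennreal (\<eta> * (1/2) ^ Suc m)" for m
    using hausdorff_measure_zeroD[OF null, of 1 "\<eta> * (1/2) ^ Suc m"] \<eta> by (metis zero_less_one zero_less_power half_gt_zero mult_pos_pos)
  then obtain U where U: "\<And>m. delta_cover 1 (A m) (U m)"
    "\<And>m. (\<Sum>i. diam_pow s (U m i)) < ennreal (\<eta> * (1/2) ^ Suc m)" by metis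
  define V where "V n = case_prod U (prod_decode n)" for n
  have "(\<Sum>n. diam_pow s (V n)) = (\<Sum>m. \<Sum>i. diam_pow s (U m i))"
    unfolding V_def
    by (rule suminf_ennreal_2dimen[where f = "\<lambda>p. diam_pow s (case_prod U p)"]) simp
  also have "\<dots> \<le> (\<Sum>m. ennreal (\<eta> * (1/2) ^ Suc m))"
    by (intro suminf_le less_imp_le U) auto
  also have "\<dots> = ennreal \<eta>"
  proof (rule suminf_ennreal_eq)
    show "(\<lambda>m. \<eta> * (1/2) ^ Suc m) sums \<eta>"
      using sums_mult[OF power_half_series, of \<eta>] by simp
  qed (use \<eta> in auto)
  finally have "(\<Sum>n. diam_pow s (V n)) \<le> ennreal \<eta>" .
  moreover have "(\<Union>m. A m) \<subseteq> (\<Union>n. V n)"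
  proof
    fix x assume "x \<in> (\<Union>m. A m)"
    then obtain m i where "x \<in> U m i" using U(1) by (force simp: delta_cover_def)
    then have "x \<in> V (prod_encode (m, i))" by (simp add: V_def)
    then show "x \<in> (\<Union>n. V n)" by blast
  qed
  moreover have "bounded (V n)" for n
    using U(1) by (auto simp: V_def delta_cover_def split: prod.split)
  ultimately show "\<exists>U. (\<Union>m. A m) \<subseteq> (\<Union>i. U i) \<and> (\<forall>i. bounded (U i)) \<and> (\<Sum>i. diam_pow s (U i)) \<le> ennreal \<eta>"
    by blast
qed

lemma hausdorff_measure_zero_Un:
  fixes A B :: "'a::metric_space set"
  assumes "s > 0" "hausdorff_measure s A = 0" "hausdorff_measure s B = 0"
  shows "hausdorff_measure s (A \<union> B) = 0"
proof -
  define F where "F m = (if m = 0 then A else B)" for m :: nat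
  have "A \<union> B = F 0 \<union> F 1" by (simp add: F_def)
  also have "\<dots> \<subseteq> (\<Union>m. F m)" by blast
  finally have "A \<union> B \<subseteq> (\<Union>m. F m)" .
  moreover have "hausdorff_measure s (\<Union>m. F m) = 0"
    using assms by (intro hausdorff_measure_zero_UN) (auto simp: F_def)
  ultimately show ?thesis by (rule hausdorff_measure_zero_mono[rotated])
qed

text \<open>The form of the criterion used for the covers below: the index set is an arbitrary countable
set, and sums are only taken over its finite subsets, so that no enumeration has to be chosen.\<close>

lemma hausdorff_measure_zero_countable_family:
  fixes A :: "'a::metric_space set"
  assumes s: "s > 0"
    and ex: "\<And>\<eta>. \<eta> > 0 \<Longrightarrow> \<exists>(\<J> :: 'b set) D d. countable \<J> \<and> A \<subseteq> (\<Union>J\<in>\<J>. D J) \<and>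
        (\<forall>J\<in>\<J>. bounded (D J) \<and> diameter (D J) \<le> d J) \<and>
        (\<forall>\<F>. finite \<F> \<longrightarrow> \<F> \<subseteq> \<J> \<longrightarrow> (\<Sum>J\<in>\<F>. d J powr s) \<le> \<eta>)"
  shows "hausdorff_measure s A = 0"
proof (rule hausdorff_measure_zeroI[OF s])
  fix \<eta> :: real assume "\<eta> > 0"
  from ex[OF this] obtain \<J> :: "'b set" and D d where J: "countable \<J>" "A \<subseteq> (\<Union>J\<in>\<J>. D J)"
    "\<And>J. J \<in> \<J> \<Longrightarrow> bounded (D J)" "\<And>J. J \<in> \<J> \<Longrightarrow> diameter (D J) \<le> d J"
    "\<And>\<F>. finite \<F> \<Longrightarrow> \<F> \<subseteq> \<J> \<Longrightarrow> (\<Sum>J\<in>\<F>. d J powr s) \<le> \<eta>" by metis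
  define f where "f = to_nat_on \<J>"
  have inj: "inj_on f \<J>" using J(1) unfolding f_def by (rule inj_on_to_nat_on)
  define U where "U n = (if n \<in> f ` \<J> then D (inv_into \<J> f n) else {})" for n
  have Uf: "U (f J) = D J" if "J \<in> \<J>" for J using that inj by (simp add: U_def inv_into_f_f)
  have "(\<Sum>i<n. diam_pow s (U i)) \<le> ennreal \<eta>" for n
  proof -
    define \<F> where "\<F> = {J\<in>\<J>. f J < n}"
    have img: "f ` \<F> = f ` \<J> \<inter> {..<n}" by (auto simp: \<F>_def)
    have fin: "finite \<F>" by (rule finite_imageD[of f]) (use inj img in \<open>auto intro: inj_on_subset simp: \<F>_def\<close>)
    have "(\<Sum>i<n. diam_pow s (U i)) = (\<Sum>i\<in>f ` \<F>. diam_pow s (U i))"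
      unfolding img by (rule sum.mono_neutral_right) (auto simp: U_def diam_pow_def)
    also have "\<dots> = (\<Sum>J\<in>\<F>. diam_pow s (U (f J)))"
      by (rule sum.reindex_cong[of f]) (use inj in \<open>auto intro: inj_on_subset simp: \<F>_def\<close>)
    also have "\<dots> \<le> (\<Sum>J\<in>\<F>. ennreal (d J powr s))"
    proof (rule sum_mono)
      fix J assume "J \<in> \<F>"
      then have J': "J \<in> \<J>" by (simp add: \<F>_def)
      have "diameter (D J) powr s \<le> d J powr s"
        using J(3,4)[OF J'] s by (intro powr_mono2) (auto simp: diameter_ge_0)
      then show "diam_pow s (U (f J)) \<le> ennreal (d J powr s)"
        using s by (auto simp: Uf[OF J'] diam_pow_def ennreal_leI)
    qed
    also have "\<dots> = ennreal (\<Sum>J\<in>\<F>. d J powr s)" by (simp add: sum_ennreal)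
    also have "\<dots> \<le> ennreal \<eta>" using J(5)[OF fin] by (intro ennreal_leI) (auto simp: \<F>_def)
    finally show ?thesis .
  qed
  then have "(\<Sum>i. diam_pow s (U i)) \<le> ennreal \<eta>"
    by (intro suminf_le_const) auto
  moreover have "A \<subseteq> (\<Union>i. U i)" using J(2) Uf by fastforce
  moreover have "bounded (U i)" for i using J(3) Uf by (auto simp: U_def inv_into_into)
  ultimately show "\<exists>U. A \<subseteq> (\<Union>i. U i) \<and> (\<forall>i. bounded (U i)) \<and> (\<Sum>i. diam_pow s (U i)) \<le> ennreal \<eta>"
    by blast
qed

lemma hausdorff_dim_le: "0 \<le> s \<Longrightarrow> hausdorff_measure s A = 0 \<Longrightarrow> hausdorff_dim A \<le> ereal s"
  unfolding hausdorff_dim_def by (intro Inf_lower) auto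

lemma hausdorff_measure_zero_if_dim_less:
  assumes "hausdorff_dim A < ereal s"
  shows "hausdorff_measure s A = 0"
proof -
  obtain s0 where "0 \<le> s0" "hausdorff_measure s0 A = 0" "s0 < s"
    using assms unfolding hausdorff_dim_def Inf_less_iff by auto
  then show ?thesis using hausdorff_measure_zero_exponent_mono by blast
qed

lemma hausdorff_dim_mono:
  assumes "A \<subseteq> B"
  shows "hausdorff_dim A \<le> hausdorff_dim B"
  unfolding hausdorff_dim_def
  using hausdorff_measure_zero_mono[OF _ assms] by (intro Inf_superset_mono) blast

section \<open>Dyadic cubes and box dimension\<close>

text \<open>The half-open dyadic cubes of side \<open>r\<close> are the fibres of this map, so covering numbers become
cardinalities of its images.\<close>

definition cube_index :: "real \<Rightarrow> real^'d \<Rightarrow> 'd \<Rightarrow> int" where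
  "cube_index r x = (\<lambda>i. \<lfloor>x $ i / r\<rfloor>)"

lemma dyadic_pos: "r \<in> dyadic \<Longrightarrow> r > 0"
  by (auto simp: dyadic_def)

lemma half_power_dyadic: "(1/2) ^ n \<in> dyadic"
proof -
  have "(1/2 :: real) ^ n = 2 powi (- int n)"
    by (simp add: power_int_minus power_one_over inverse_eq_divide)
  then show ?thesis unfolding dyadic_def by blast
qed

lemma dyadic_mult_power: "r \<in> dyadic \<Longrightarrow> r * 2 ^ n \<in> dyadic"
proof -
  assume "r \<in> dyadic"
  then obtain k where "r = 2 powi k" by (auto simp: dyadic_def)
  then have "r * 2 ^ n = 2 powi (k + int n)" by (simp add: power_int_add)
  then show ?thesis unfolding dyadic_def by blast
qed

lemma cube_index_eq_iff:
  assumes "r > 0"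
  shows "cube_index r x = k \<longleftrightarrow> (\<forall>i. r * of_int (k i) \<le> x $ i \<and> x $ i < r * (of_int (k i) + 1))"
  using assms by (simp add: cube_index_def fun_eq_iff floor_eq_iff field_simps)

lemma dyadic_cubes_meeting_eq:
  fixes P :: "(real^'d) set"
  assumes "r > 0"
  shows "dyadic_cubes_meeting r P = (\<lambda>k. {x. cube_index r x = k}) ` cube_index r ` P"
proof -
  have "dyadic_cubes r = range (\<lambda>k. {x::real^'d. cube_index r x = k})"
    unfolding dyadic_cubes_def using assms by (simp add: cube_index_eq_iff)
  then show ?thesis unfolding dyadic_cubes_meeting_def by auto
qed

lemma covering_number_eq:
  assumes "r > 0"
  shows "covering_number r P = card (cube_index r ` P)"
  unfolding covering_number_def dyadic_cubes_meeting_eq[OF assms]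
  by (rule card_image) (auto simp: inj_on_def)

lemma cube_index_component_dist:
  assumes "r > 0"
  shows "\<bar>x $ i - r * of_int (cube_index r x i)\<bar> \<le> r"
proof -
  have "r * of_int (cube_index r x i) \<le> x $ i \<and> x $ i < r * (of_int (cube_index r x i) + 1)"
    using cube_index_eq_iff[OF assms, of x "cube_index r x"] by blast
  then show ?thesis by (simp add: algebra_simps)
qed

lemma finite_bounded_int_functions:
  fixes F :: "'d::finite \<Rightarrow> int set"
  assumes "\<And>i. finite (F i)"
  shows "finite {k. \<forall>i. k i \<in> F i}"
proof -
  have "{k. \<forall>i. k i \<in> F i} = PiE UNIV F" by auto
  then show ?thesis using assms by (simp add: finite_PiE)
qed

lemma finite_cube_index:
  fixes X :: "(real^'d) set"
  assumes "bounded X" "r > 0"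
  shows "finite (cube_index r ` X)"
proof -
  obtain B where B: "\<And>x. x \<in> X \<Longrightarrow> norm x \<le> B" using assms(1) by (auto simp: bounded_iff)
  have "cube_index r ` X \<subseteq> {k. \<forall>i. k i \<in> {\<lfloor>- B / r\<rfloor>..\<lfloor>B / r\<rfloor>}}"
  proof clarify
    fix x i assume "x \<in> X"
    then have "\<bar>x $ i\<bar> \<le> B" using B component_le_norm_cart order_trans by blast
    then have "- B \<le> x $ i" "x $ i \<le> B" by auto
    then show "cube_index r x i \<in> {\<lfloor>- B / r\<rfloor>..\<lfloor>B / r\<rfloor>}"
      using assms(2) divide_right_mono[of "- B" "x $ i" r] divide_right_mono[of "x $ i" B r]
      by (auto simp: cube_index_def intro!: floor_mono)
  qed
  then show ?thesis by (rule finite_subset) (rule finite_bounded_int_functions, simp)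
qed

lemma cube_diameter:
  fixes X :: "(real^'d) set" and r :: real
  assumes "r > 0"
  shows "bounded {x\<in>X. cube_index r x = k} \<and> diameter {x\<in>X. cube_index r x = k} \<le> CARD('d) * r"
proof -
  have *: "norm (x - y) \<le> real CARD('d) * r" if "cube_index r x = k" "cube_index r y = k" for x y :: "real^'d"
  proof -
    have "norm (x - y) \<le> (\<Sum>i\<in>UNIV. \<bar>(x - y) $ i\<bar>)" by (rule norm_le_l1_cart)
    also have "\<dots> \<le> (\<Sum>i\<in>(UNIV::'d set). r :: real)"
    proof (rule sum_mono)
      fix i
      show "\<bar>(x - y) $ i\<bar> \<le> r"
        using that unfolding cube_index_eq_iff[OF assms]
        by (auto simp: algebra_simps abs_le_iff dest!: spec[of _ i])
    qed
    finally show ?thesis by simp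
  qed
  have "diameter {x\<in>X. cube_index r x = k} \<le> CARD('d) * r"
    using * assms by (intro diameter_le) auto
  moreover have "bounded {x\<in>X. cube_index r x = k}"
  proof (cases "{x\<in>X. cube_index r x = k} = {}")
    case False
    then obtain y where "cube_index r y = k" by blast
    then show ?thesis using * unfolding bounded_def by (intro exI[of _ y] exI[of _ "CARD('d) * r"]) (auto simp: dist_norm)
  qed (metis bounded_empty)
  ultimately show ?thesis by blast
qed

text \<open>Sub-uniform distribution for an arbitrary piece \<open>X\<close> of \<open>K\<close> instead of a single cube, obtained by
summing over the \<open>R\<close>-cubes that meet \<open>X\<close>. Read as an upper bound on the proportion of
\<open>r\<close>-cubes of \<open>K\<close> that lie in \<open>X\<close>, it says that this proportion is at most \<open>C\<close> times the one at scale \<open>R\<close>.\<close>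

definition sub_uniform_const :: "real \<Rightarrow> (real^'d) set \<Rightarrow> bool" where
  "sub_uniform_const C K \<longleftrightarrow> (\<forall>r\<in>dyadic. \<forall>R\<in>dyadic. r \<le> R \<longrightarrow> (\<forall>X\<subseteq>K.
     real (card (cube_index R ` K)) * real (card (cube_index r ` X))
       \<le> C * real (card (cube_index r ` K)) * real (card (cube_index R ` X))))"

lemma sub_uniformly_distributed_const:
  fixes K :: "(real^'d) set"
  assumes "sub_uniformly_distributed K"
  obtains C where "C > 0" "sub_uniform_const C K"
proof -
  have bdd: "bounded K" using assms by (simp add: sub_uniformly_distributed_def)
  obtain C where C: "C > 0" "\<And>r R Q. r \<in> dyadic \<Longrightarrow> R \<in> dyadic \<Longrightarrow> r \<le> R \<Longrightarrow> Q \<in> dyadic_cubes_meeting R K \<Longrightarrow>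
     real (covering_number R K) * real (covering_number r (K \<inter> Q)) \<le> C * real (covering_number r K)"
    using assms unfolding sub_uniformly_distributed_def by metis
  have "real (card (cube_index R ` K)) * real (card (cube_index r ` X))
       \<le> C * real (card (cube_index r ` K)) * real (card (cube_index R ` X))"
    if rR: "r \<in> dyadic" "R \<in> dyadic" "r \<le> R" and X: "X \<subseteq> K" for r R X
  proof -
    have pos: "r > 0" "R > 0" using rR dyadic_pos by auto
    define N where "N = real (card (cube_index R ` K))"
    define Y where "Y q = {x\<in>K. cube_index R x = q}" for q
    have finX: "finite (cube_index R ` X)" using finite_cube_index bounded_subset[OF bdd X] pos by blast
    have finY: "finite (cube_index r ` Y q)" for q
      using finite_cube_index[of "Y q" r] bounded_subset[OF bdd, of "Y q"] pos by (auto simp: Y_def)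
    have cell: "N * card (cube_index r ` Y q) \<le> C * card (cube_index r ` K)" if "q \<in> cube_index R ` X" for q
    proof -
      have "{x. cube_index R x = q} \<in> dyadic_cubes_meeting R K"
        unfolding dyadic_cubes_meeting_eq[OF pos(2)] using that X by auto
      from C(2)[OF rR this] show ?thesis
        by (simp add: covering_number_eq pos N_def Y_def Int_def)
    qed
    have "card (cube_index r ` X) \<le> card (\<Union>q\<in>cube_index R ` X. cube_index r ` Y q)"
      using finY X by (intro card_mono finite_UN_I finX) (auto simp: Y_def)
    also have "\<dots> \<le> (\<Sum>q\<in>cube_index R ` X. card (cube_index r ` Y q))"
      using finX by (rule card_UN_le)
    finally have "N * card (cube_index r ` X) \<le> N * (\<Sum>q\<in>cube_index R ` X. real (card (cube_index r ` Y q)))"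
      by (intro mult_left_mono) (simp_all add: N_def flip: of_nat_sum)
    also have "\<dots> = (\<Sum>q\<in>cube_index R ` X. N * card (cube_index r ` Y q))" by (simp add: sum_distrib_left)
    also have "\<dots> \<le> (\<Sum>q\<in>cube_index R ` X. C * card (cube_index r ` K))"
      by (intro sum_mono cell)
    finally show ?thesis by (simp add: N_def mult_ac)
  qed
  then have "sub_uniform_const C K" by (auto simp: sub_uniform_const_def)
  with C(1) show ?thesis by (rule that)
qed

lemma half_powr_less: "e > 0 \<Longrightarrow> (1/2 :: real) powr e < 1"
  using powr_less_mono2[of e "1/2" 1] by simp

text \<open>Hausdorff dimension is at most lower box dimension: cover by all cubes of a single good scale.\<close>

lemma hausdorff_measure_zero_if_few_cubes:
  fixes X :: "(real^'d) set"
  assumes "bounded X" "s' > 0" "s < s'"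
    and few: "\<exists>\<^sub>F n in sequentially. card (cube_index ((1/2) ^ n) ` X) \<le> ((1/2) ^ n) powr (- s)"
  shows "hausdorff_measure s' X = 0"
proof (rule hausdorff_measure_zero_countable_family[OF assms(2)])
  fix \<eta> :: real assume \<eta>: "\<eta> > 0"
  define c where "c = real CARD('d)"
  have c: "c \<ge> 1" by (simp add: c_def Suc_leI)
  have "(\<lambda>n. c powr s' * ((1/2) powr (s' - s)) ^ n) \<longlonglongrightarrow> c powr s' * 0"
    using assms(3) by (intro tendsto_mult tendsto_const LIMSEQ_power_zero) (simp add: half_powr_less)
  then have "\<forall>\<^sub>F n in sequentially. c powr s' * ((1/2) powr (s' - s)) ^ n < \<eta>"
    using \<eta> by (intro order_tendstoD) auto
  from frequently_eventually_conj[OF few this] obtain n where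
    n: "card (cube_index ((1/2) ^ n) ` X) \<le> ((1/2) ^ n) powr (- s)"
       "c powr s' * ((1/2) powr (s' - s)) ^ n < \<eta>"
    by (auto dest: frequently_ex)
  define r :: real where "r = (1/2) ^ n"
  have r: "r > 0" by (simp add: r_def)
  have rp: "r powr (s' - s) = ((1/2) powr (s' - s)) ^ n"
    by (simp add: r_def powr_power powr_powr flip: powr_realpow) (simp add: powr_powr mult.commute)
  have "card (cube_index r ` X) * (c * r) powr s' \<le> r powr (-s) * (c * r) powr s'"
    using n(1) by (intro mult_right_mono) (auto simp: r_def)
  also have "\<dots> = c powr s' * r powr (s' - s)"
    using r c by (simp add: powr_mult powr_diff powr_minus field_simps)
  also have "\<dots> \<le> \<eta>" using n(2) by (simp add: rp)
  finally have le: "card (cube_index r ` X) * (c * r) powr s' \<le> \<eta>" .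
  show "\<exists>(\<J> :: ('d \<Rightarrow> int) set) D d. countable \<J> \<and> X \<subseteq> (\<Union>J\<in>\<J>. D J) \<and>
        (\<forall>J\<in>\<J>. bounded (D J) \<and> diameter (D J) \<le> d J) \<and>
        (\<forall>\<F>. finite \<F> \<longrightarrow> \<F> \<subseteq> \<J> \<longrightarrow> (\<Sum>J\<in>\<F>. d J powr s') \<le> \<eta>)"
  proof (intro exI conjI allI impI)
    have fin: "finite (cube_index r ` X)" using finite_cube_index assms(1) r by blast
    show "countable (cube_index r ` X)" using fin by (rule countable_finite)
    show "X \<subseteq> (\<Union>k\<in>cube_index r ` X. {x\<in>X. cube_index r x = k})" by auto
    show "\<forall>k\<in>cube_index r ` X. bounded {x\<in>X. cube_index r x = k} \<and> diameter {x\<in>X. cube_index r x = k} \<le> c * r"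
      using cube_diameter[OF r] by (auto simp: c_def)
    fix \<F> :: "('d \<Rightarrow> int) set" assume F: "finite \<F>" "\<F> \<subseteq> cube_index r ` X"
    have "(\<Sum>J\<in>\<F>. (c * r) powr s') = card \<F> * (c * r) powr s'" by simp
    also have "\<dots> \<le> card (cube_index r ` X) * (c * r) powr s'"
      using card_mono[OF fin F(2)] by (intro mult_right_mono) auto
    finally show "(\<Sum>J\<in>\<F>. (c * r) powr s') \<le> \<eta>" using le by linarith
  qed
qed

lemma dyadic_scale_above:
  fixes d :: real
  assumes "0 < d" "d \<le> 1"
  obtains n where "d \<le> (1/2) ^ n" "(1/2) ^ n < 2 * d"
proof -
  define n where "n = (LEAST m. (1/2 :: real) ^ m < 2 * d)"
  have ex: "\<exists>m. (1/2 :: real) ^ m < 2 * d" using assms by (intro real_arch_pow_inv) auto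
  have n: "(1/2) ^ n < 2 * d" unfolding n_def using ex by (rule LeastI_ex)
  have "d \<le> (1/2) ^ n"
  proof (cases n)
    case (Suc k)
    have "\<not> (1/2 :: real) ^ k < 2 * d" using not_less_Least[of k "\<lambda>m. (1/2 :: real) ^ m < 2 * d"] Suc
      by (simp add: n_def)
    then show ?thesis using Suc by simp
  qed (use assms in simp)
  with n show ?thesis using that by blast
qed

lemma card_cube_index_ball:
  fixes p :: "real^'d"
  assumes "d \<le> R" "R > 0"
  shows "card (cube_index R ` (X \<inter> ball p d)) \<le> 3 ^ CARD('d)"
proof -
  define F where "F i = {cube_index R p i - 1 .. cube_index R p i + 1}" for i
  have "cube_index R ` (X \<inter> ball p d) \<subseteq> PiE UNIV F"
  proof clarify
    fix x assume "x \<in> ball p d"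
    then have "\<bar>(p - x) $ i\<bar> < R" for i
      using component_le_norm_cart[of "p - x" i] assms by (simp add: dist_norm)
    then have *: "\<bar>p $ i / R - x $ i / R\<bar> < 1" for i
      using assms by (simp add: diff_divide_distrib[symmetric] abs_divide)
    have "cube_index R x i \<in> F i" for i
      using *[of i] unfolding F_def cube_index_def by (simp add: abs_less_iff) linarith
    then show "cube_index R x \<in> PiE UNIV F" by auto
  qed
  then have "card (cube_index R ` (X \<inter> ball p d)) \<le> card (PiE UNIV F)"
    by (intro card_mono finite_PiE) (auto simp: F_def)
  also have "\<dots> = 3 ^ CARD('d)" by (simp add: card_PiE F_def)
  finally show ?thesis .
qed

text \<open>The mass distribution principle, in contrapositive form and without a limiting measure. If \<open>K\<close> had
many cubes at every small scale, then by sub-uniform distribution a set of diameter \<open>d\<close> would contain at most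
a proportion \<open>O(d powr \<sigma>)\<close> of the cubes of any finer scale, and a cover with
small \<open>\<sigma>\<close>-dimensional sum could not account for all of them. Compactness supplies a finite cover, hence a finest
scale at which to count.\<close>

lemma few_cubes_if_hausdorff_measure_zero:
  fixes K :: "(real^'d) set"
  assumes K: "compact K" "K \<noteq> {}" and C: "C > 0" "sub_uniform_const C K"
    and \<sigma>: "\<sigma> > 0" "hausdorff_measure \<sigma> K = 0"
  shows "\<exists>\<^sub>F n in sequentially. card (cube_index ((1/2) ^ n) ` K) \<le> ((1/2) ^ n) powr (- \<sigma>)"
proof (rule ccontr)
  assume "\<not> ?thesis"
  then obtain n0 where n0: "\<And>n. n \<ge> n0 \<Longrightarrow> ((1/2) ^ n) powr (- \<sigma>) < card (cube_index ((1/2) ^ n) ` K)"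
    by (auto simp: not_frequently not_le eventually_sequentially)
  define M :: real where "M = 3 ^ CARD('d)"
  have M: "M > 0" by (simp add: M_def)
  define A where "A = M * C * 2 powr \<sigma>"
  have A: "A > 0" using M C by (simp add: A_def)
  define \<eta> where "\<eta> = min (1 / (4 * A)) (((1/2) ^ (n0 + 1)) powr \<sigma> / 2)"
  have \<eta>: "\<eta> > 0" "2 * A * \<eta> < 1" "2 * \<eta> \<le> ((1/2) ^ (n0 + 1)) powr \<sigma>"
  proof -
    show "\<eta> > 0" using A by (simp add: \<eta>_def)
    have "\<eta> \<le> 1 / (4 * A)" by (simp add: \<eta>_def)
    then show "2 * A * \<eta> < 1" using A by (simp add: field_simps)
    show "2 * \<eta> \<le> ((1/2) ^ (n0 + 1)) powr \<sigma>" by (simp add: \<eta>_def)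
  qed
  obtain U where U: "delta_cover 1 K U" "(\<Sum>i. diam_pow \<sigma> (U i)) < ennreal \<eta>"
    using hausdorff_measure_zeroD[OF \<sigma>(2) zero_less_one \<eta>(1)] .
  have dp: "diam_pow \<sigma> (U i) = ennreal (diameter (U i) powr \<sigma>)" for i
    using \<sigma>(1) by (auto simp: diam_pow_def diameter_def)
  \<comment> \<open>Enlarged diameters: strictly larger, so that open balls of radius \<open>d i\<close> cover, and positive even for
    one-point sets; the extra terms add up to \<open>\<eta>\<close>.\<close>
  define d where "d i = (diameter (U i) powr \<sigma> + \<eta> * (1/2) ^ Suc i) powr (1 / \<sigma>)" for i
  have d\<sigma>: "d i powr \<sigma> = diameter (U i) powr \<sigma> + \<eta> * (1/2) ^ Suc i" for i
  proof -
    have cancel: "(X powr (1 / \<sigma>)) powr \<sigma> = X" if "X > 0" for X :: real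
      using that \<sigma>(1) by (simp add: powr_powr)
    show ?thesis unfolding d_def using \<eta>(1) by (intro cancel add_nonneg_pos) auto
  qed
  have dgt: "diameter (U i) < d i" for i
  proof -
    have "diameter (U i) powr \<sigma> < d i powr \<sigma>" unfolding d\<sigma> using \<eta>(1) by simp
    then show ?thesis using \<sigma>(1) by (metis d_def linorder_not_le powr_ge_zero powr_mono2 less_imp_le)
  qed
  have dsum: "(\<Sum>i\<in>I. d i powr \<sigma>) \<le> 2 * \<eta>" if "finite I" for I
  proof -
    have "ennreal (\<Sum>i\<in>I. diameter (U i) powr \<sigma>) = (\<Sum>i\<in>I. diam_pow \<sigma> (U i))" by (simp add: dp sum_ennreal)
    also have "\<dots> \<le> (\<Sum>i. diam_pow \<sigma> (U i))" using that by (intro sum_le_suminf) auto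
    also have "\<dots> \<le> ennreal \<eta>" using U(2) by simp
    finally have 1: "(\<Sum>i\<in>I. diameter (U i) powr \<sigma>) \<le> \<eta>" using \<eta>(1) by (simp add: ennreal_le_iff)
    have "(\<Sum>i\<in>I. \<eta> * (1/2) ^ Suc i) \<le> (\<Sum>i. \<eta> * (1/2) ^ Suc i)"
      using that \<eta>(1) sums_mult[OF power_half_series, of \<eta>] by (intro sum_le_suminf) (auto simp: sums_iff)
    also have "\<dots> = \<eta>" using sums_mult[OF power_half_series, of \<eta>] by (simp add: sums_iff)
    finally show ?thesis using 1 by (simp add: d\<sigma> sum.distrib)
  qed
  have dsmall: "0 < d i \<and> d i \<le> (1/2) ^ (n0 + 1)" for i
  proof
    show "0 < d i" using dgt[of i] diameter_ge_0[of "U i"] U(1) by (auto simp: delta_cover_def intro: le_less_trans)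
    have "d i powr \<sigma> \<le> ((1/2) ^ (n0 + 1)) powr \<sigma>" using dsum[of "{i}"] \<eta>(3) by simp
    then show "d i \<le> (1/2) ^ (n0 + 1)" using \<sigma>(1)
      by (metis linorder_not_le powr_less_mono2 zero_le_power zero_le_divide_1_iff zero_le_numeral)
  qed
  have "\<exists>n. d i \<le> (1/2) ^ n \<and> (1/2) ^ n < 2 * d i" for i
  proof -
    have "d i \<le> 1" using dsmall[of i] power_le_one[of "1/2::real" "n0 + 1"] by simp
    then show ?thesis using dyadic_scale_above[of "d i"] dsmall[of i] by metis
  qed
  then obtain m where m: "\<And>i. d i \<le> (1/2) ^ m i" "\<And>i. (1/2) ^ m i < 2 * d i" by metis
  have mn0: "m i \<ge> n0" for i
  proof (rule ccontr)
    assume "\<not> m i \<ge> n0"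
    then have "(1/2 :: real) ^ n0 \<le> (1/2) ^ m i" by (intro power_decreasing) auto
    moreover have "2 * d i \<le> (1/2) ^ n0" using dsmall[of i] by simp
    ultimately show False using m(2)[of i] by linarith
  qed
  define p where "p i = (SOME x. x \<in> U i)" for i
  have "K \<subseteq> (\<Union>i. ball (p i) (d i))"
  proof
    fix x assume "x \<in> K"
    then obtain i where i: "x \<in> U i" using U(1) by (auto simp: delta_cover_def)
    then have "p i \<in> U i" unfolding p_def by (rule someI)
    then have "dist (p i) x \<le> diameter (U i)" using U(1) i by (intro diameter_bounded_bound) (auto simp: delta_cover_def)
    then show "x \<in> (\<Union>i. ball (p i) (d i))" using dgt[of i] by (intro UN_I[of i]) auto
  qed
  then obtain I where I: "finite I" "K \<subseteq> (\<Union>i\<in>I. ball (p i) (d i))"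
    using compactE_image[OF K(1), of UNIV "\<lambda>i. ball (p i) (d i)"] by auto
  have "I \<noteq> {}" using I K(2) by auto
  \<comment> \<open>All sets of the finite cover live at scales coarser than \<open>r = (1/2) ^ n\<close>, where the cubes are counted.\<close>
  define n where "n = Max (m ` I)"
  define r :: real where "r = (1/2) ^ n"
  define N where "N = real (card (cube_index r ` K))"
  have r: "r > 0" "r \<in> dyadic" by (auto simp: r_def half_power_dyadic)
  have bdd: "bounded K" using K(1) by (rule compact_imp_bounded)
  have finK: "finite (cube_index r ` Y)" if "Y \<subseteq> K" for Y
    using finite_cube_index r bounded_subset[OF bdd that] by blast
  have N: "N > 0" using finK[OF order_refl] K(2) by (simp add: N_def card_gt_0_iff)
  have piece: "card (cube_index r ` (K \<inter> ball (p i) (d i))) \<le> N * A * d i powr \<sigma>" if "i \<in> I" for i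
  proof -
    define R :: real where "R = (1/2) ^ m i"
    define NR where "NR = real (card (cube_index R ` K))"
    have R: "R \<in> dyadic" "R > 0" by (auto simp: R_def half_power_dyadic)
    have "m i \<le> n" using that I(1) by (simp add: n_def)
    then have rR: "r \<le> R" by (simp add: r_def R_def power_decreasing)
    have NR: "R powr (- \<sigma>) < NR" using n0[OF mn0[of i]] by (simp add: R_def NR_def)
    then have "NR > 0" using powr_ge_zero[of R "-\<sigma>"] by linarith
    have "NR * card (cube_index r ` (K \<inter> ball (p i) (d i)))
        \<le> C * N * card (cube_index R ` (K \<inter> ball (p i) (d i)))"
      using C(2) r R rR by (simp add: sub_uniform_const_def NR_def N_def)
    also have "\<dots> \<le> C * N * M"
      using card_cube_index_ball[of "d i" R K "p i"] m(1)[of i] R C(1) N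
      by (intro mult_left_mono) (auto simp: R_def M_def simp flip: of_nat_le_iff)
    finally have "card (cube_index r ` (K \<inter> ball (p i) (d i))) \<le> C * N * M / NR"
      using \<open>NR > 0\<close> by (simp add: field_simps)
    also have "\<dots> \<le> C * N * M * R powr \<sigma>"
    proof -
      have "1 / NR \<le> 1 / R powr (- \<sigma>)" using NR R \<open>NR > 0\<close> by (intro divide_left_mono) (auto intro!: mult_pos_pos)
      then have "1 / NR \<le> R powr \<sigma>" by (simp add: powr_minus_divide)
      then have "C * N * M * (1 / NR) \<le> C * N * M * R powr \<sigma>" using C N M by (intro mult_left_mono) auto
      then show ?thesis by simp
    qed
    also have "\<dots> \<le> C * N * M * (2 * d i) powr \<sigma>"
      using m(2)[of i] \<sigma>(1) C N M R by (intro mult_left_mono powr_mono2) (auto simp: R_def)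
    also have "\<dots> = N * A * d i powr \<sigma>" using dsmall[of i] by (simp add: A_def powr_mult)
    finally show ?thesis .
  qed
  have "cube_index r ` K \<subseteq> (\<Union>i\<in>I. cube_index r ` (K \<inter> ball (p i) (d i)))" using I(2) by blast
  then have "card (cube_index r ` K) \<le> card (\<Union>i\<in>I. cube_index r ` (K \<inter> ball (p i) (d i)))"
    using I(1) by (intro card_mono) (auto intro: finK)
  also have "\<dots> \<le> (\<Sum>i\<in>I. card (cube_index r ` (K \<inter> ball (p i) (d i))))" using I(1) by (rule card_UN_le)
  finally have "N \<le> (\<Sum>i\<in>I. real (card (cube_index r ` (K \<inter> ball (p i) (d i)))))"
    by (simp add: N_def flip: of_nat_sum)
  also have "\<dots> \<le> (\<Sum>i\<in>I. N * A * d i powr \<sigma>)" by (intro sum_mono piece)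
  also have "\<dots> = N * A * (\<Sum>i\<in>I. d i powr \<sigma>)" by (simp add: sum_distrib_left)
  also have "\<dots> \<le> N * A * (2 * \<eta>)" using dsum[OF I(1)] N A by (intro mult_left_mono) auto
  also have "\<dots> = N * (2 * A * \<eta>)" by simp
  also have "\<dots> < N * 1" using N \<eta>(2) by (intro mult_strict_left_mono) auto
  finally show False by simp
qed

section \<open>Averages of a mean-zero kernel over slopes\<close>

definition autocorr :: "(real \<Rightarrow> real) \<Rightarrow> real \<Rightarrow> real" where
  "autocorr \<psi> v = (\<integral>u. \<psi> u * \<psi> (u + v) \<partial>lborel)"

text \<open>The weight on slopes. A sharp cutoff would destroy the cancellation of a mean-zero kernel against
the slopes near the cutoff; Lipschitz continuity is what the decay estimate needs.\<close>

definition tent :: "real \<Rightarrow> real" where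
  "tent a = max 0 (2 - \<bar>a\<bar>)"

lemma tent_measurable [measurable]: "tent \<in> borel_measurable borel"
  unfolding tent_def by measurable

lemma tent_nonneg: "tent a \<ge> 0" and tent_le_2: "tent a \<le> 2"
  and tent_eq_0: "\<bar>a\<bar> > 2 \<Longrightarrow> tent a = 0"
  and tent_ge_1: "\<bar>a\<bar> \<le> 1 \<Longrightarrow> 1 \<le> tent a"
  by (auto simp: tent_def)

lemma tent_lipschitz: "\<bar>tent a - tent b\<bar> \<le> \<bar>a - b\<bar>"
  unfolding tent_def by (simp add: abs_le_iff max_def) linarith

lemma integrable_supported:
  fixes f :: "'a \<Rightarrow> real"
  assumes "f \<in> borel_measurable M" "A \<in> sets M" "emeasure M A < \<infinity>"
    and "\<And>x. \<bar>f x\<bar> \<le> B" "\<And>x. x \<notin> A \<Longrightarrow> f x = 0"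
  shows "integrable M f"
proof (rule Bochner_Integration.integrable_bound[of M "\<lambda>x. indicator A x * B"])
  show "integrable M (\<lambda>x. indicator A x * B)"
    using assms(2,3) by (intro integrable_mult_left) (auto intro: integrable_real_indicator)
  show "AE x in M. norm (f x) \<le> norm (indicator A x * B)"
  proof (rule AE_I2)
    fix x
    show "norm (f x) \<le> norm (indicator A x * B)"
      using assms(4)[of x] assms(5)[of x] by (cases "x \<in> A") auto
  qed
qed fact

locale kernel =
  fixes \<psi> :: "real \<Rightarrow> real" and M B c :: real
  assumes meas [measurable]: "\<psi> \<in> borel_measurable borel"
    and bound: "\<And>u. \<bar>\<psi> u\<bar> \<le> M"
    and supp: "\<And>u. \<bar>u\<bar> > B \<Longrightarrow> \<psi> u = 0"
    and mean_zero: "(\<integral>u. \<psi> u \<partial>lborel) = 0"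
    and L1: "(\<integral>u. \<bar>\<psi> u\<bar> \<partial>lborel) \<le> c"
    and B_pos: "B > 0"
begin

lemma M_nonneg: "M \<ge> 0" using bound[of 0] by linarith
lemma c_nonneg: "c \<ge> 0"
proof -
  have "0 \<le> (\<integral>u. \<bar>\<psi> u\<bar> \<partial>lborel)" by (rule Bochner_Integration.integral_nonneg) simp
  with L1 show ?thesis by linarith
qed

lemma integrable_times:
  assumes [measurable]: "f \<in> borel_measurable borel" and "\<And>u. \<bar>f u\<bar> \<le> D"
  shows "integrable lborel (\<lambda>u. \<psi> u * f u)"
proof (rule integrable_supported[of _ _ "{-B..B}"])
  show "\<bar>\<psi> u * f u\<bar> \<le> M * D" for u
    unfolding abs_mult using bound[of u] assms(2)[of u] by (intro mult_mono) auto
  show "u \<notin> {-B..B} \<Longrightarrow> \<psi> u * f u = 0" for u using supp[of u] by (auto simp: abs_if)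
  show "emeasure lborel {-B..B} < \<infinity>" using B_pos by simp
qed auto

lemma integrable: "integrable lborel \<psi>"
  using integrable_times[of "\<lambda>_. 1" 1] by simp

lemma autocorr_bound: "\<bar>autocorr \<psi> v\<bar> \<le> M * c"
proof -
  have "\<bar>autocorr \<psi> v\<bar> \<le> (\<integral>u. \<bar>\<psi> u * \<psi> (u + v)\<bar> \<partial>lborel)"
    unfolding autocorr_def by (rule integral_abs_bound)
  also have "\<dots> \<le> (\<integral>u. \<bar>\<psi> u\<bar> * M \<partial>lborel)"
  proof (rule integral_mono)
    show "integrable lborel (\<lambda>u. \<bar>\<psi> u * \<psi> (u + v)\<bar>)"
      using integrable_times[of "\<lambda>u. \<psi> (u + v)" M] bound by (intro integrable_abs) auto
    show "integrable lborel (\<lambda>u. \<bar>\<psi> u\<bar> * M)" using integrable by auto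
    show "\<bar>\<psi> u * \<psi> (u + v)\<bar> \<le> \<bar>\<psi> u\<bar> * M" for u
      unfolding abs_mult using bound by (intro mult_left_mono) auto
  qed
  also have "\<dots> \<le> M * c" using mult_left_mono[OF L1 M_nonneg] by (simp add: mult.commute)
  finally show ?thesis .
qed

lemma autocorr_supp:
  assumes "\<bar>v\<bar> > 2 * B" shows "autocorr \<psi> v = 0"
proof -
  have "\<psi> u * \<psi> (u + v) = 0" for u
    using supp[of u] supp[of "u + v"] assms by (cases "\<bar>u\<bar> > B") auto
  then show ?thesis unfolding autocorr_def by (simp only: integral_zero)
qed

lemma integrable_pair:
  "integrable (lborel \<Otimes>\<^sub>M lborel) (\<lambda>(u, a). \<psi> u * (tent a * \<psi> (u + (x + a * y))))"
proof (rule integrable_supported[of _ _ "{-B..B} \<times> {-2..2}"])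
  have "emeasure (lborel \<Otimes>\<^sub>M lborel) ({-B..B} \<times> {-2..2 :: real}) = emeasure lborel {-B..B} * emeasure lborel {-2..2::real}"
    by (intro lborel.emeasure_pair_measure_Times) auto
  also have "\<dots> < \<infinity>" using B_pos by (simp add: ennreal_mult_less_top)
  finally show "emeasure (lborel \<Otimes>\<^sub>M lborel) ({-B..B} \<times> {-2..2 :: real}) < \<infinity>" .
  show "\<bar>case p of (u, a) \<Rightarrow> \<psi> u * (tent a * \<psi> (u + (x + a * y)))\<bar> \<le> M * (2 * M)" for p
    unfolding split_def abs_mult using bound tent_le_2 M_nonneg
    by (intro mult_mono) (auto simp: tent_nonneg)
  show "p \<notin> {-B..B} \<times> {-2..2} \<Longrightarrow> (case p of (u, a) \<Rightarrow> \<psi> u * (tent a * \<psi> (u + (x + a * y)))) = 0" for p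
  proof -
    assume "p \<notin> {-B..B} \<times> {-2..2}"
    then have "B < \<bar>fst p\<bar> \<or> 2 < \<bar>snd p\<bar>" by (cases p) auto
    then show ?thesis using supp[of "fst p"] tent_eq_0[of "snd p"] by (auto simp: split_def)
  qed
qed (auto simp: split_def)

lemma integrable_tent_autocorr: "integrable lborel (\<lambda>a. tent a * autocorr \<psi> (x + a * y))"
proof -
  have "integrable lborel (\<lambda>a. \<integral>u. \<psi> u * (tent a * \<psi> (u + (x + a * y))) \<partial>lborel)"
    using lborel_pair.integrable_snd[OF integrable_pair[of x y]] .
  moreover have "(\<integral>u. \<psi> u * (tent a * \<psi> (u + (x + a * y))) \<partial>lborel) = tent a * autocorr \<psi> (x + a * y)" for a
    unfolding autocorr_def by (subst integral_mult_right_zero[symmetric]) (simp add: mult_ac)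
  ultimately show ?thesis by simp
qed

text \<open>Substituting \<open>v = x + a * y\<close> turns the average over slopes into an integral of \<open>\<psi>\<close> against a rescaled
tent, which varies by at most \<open>B / \<bar>y\<bar>\<close> on the support of \<open>\<psi>\<close>. Subtracting a constant from the tent is
free because \<open>\<psi>\<close> has mean zero; this gains the second factor \<open>1 / \<bar>y\<bar>\<close>.\<close>

lemma tent_average_bound:
  assumes u: "y \<noteq> 0"
  shows "\<bar>\<integral>a. tent a * \<psi> (x + a * y) \<partial>lborel\<bar> \<le> B * c / y\<^sup>2"
proof -
  define f where "f v = \<psi> v * (tent ((v - x) / y) - tent (- x / y))" for v
  have "(\<integral>v. \<psi> v * tent ((v - x) / y) \<partial>lborel) = \<bar>y\<bar> * (\<integral>a. tent a * \<psi> (x + a * y) \<partial>lborel)"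
    using u by (subst lborel_integral_real_affine[of y _ x]) (auto simp: mult_ac)
  moreover have "(\<integral>v. f v \<partial>lborel) = (\<integral>v. \<psi> v * tent ((v - x) / y) \<partial>lborel)"
  proof -
    have "(\<integral>v. f v \<partial>lborel) = (\<integral>v. \<psi> v * tent ((v - x) / y) - \<psi> v * tent (- x / y) \<partial>lborel)"
      unfolding f_def by (simp add: algebra_simps)
    also have "\<dots> = (\<integral>v. \<psi> v * tent ((v - x) / y) \<partial>lborel) - (\<integral>v. \<psi> v * tent (- x / y) \<partial>lborel)"
      by (rule Bochner_Integration.integral_diff)
         (auto intro!: integrable_times[where D = 2] simp: integrable tent_nonneg tent_le_2 abs_of_nonneg)
    also have "(\<integral>v. \<psi> v * tent (- x / y) \<partial>lborel) = (\<integral>v. \<psi> v \<partial>lborel) * tent (- x / y)"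
      by (rule integral_mult_left_zero)
    finally show ?thesis by (simp only: mean_zero mult_zero_left diff_zero)
  qed
  moreover have "\<bar>\<integral>v. f v \<partial>lborel\<bar> \<le> B * c / \<bar>y\<bar>"
  proof -
    have fb: "\<bar>f v\<bar> \<le> \<bar>\<psi> v\<bar> * (B / \<bar>y\<bar>)" for v
    proof (cases "\<bar>v\<bar> > B")
      case False
      have "\<bar>tent ((v - x) / y) - tent (- x / y)\<bar> \<le> \<bar>(v - x) / y - (- x / y)\<bar>" by (rule tent_lipschitz)
      also have "\<dots> = \<bar>v\<bar> / \<bar>y\<bar>" by (simp add: diff_divide_distrib abs_divide)
      also have "\<dots> \<le> B / \<bar>y\<bar>" using False by (intro divide_right_mono) auto
      finally show ?thesis unfolding f_def abs_mult by (intro mult_left_mono) auto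
    qed (simp add: f_def supp)
    have "\<bar>\<integral>v. f v \<partial>lborel\<bar> \<le> (\<integral>v. \<bar>f v\<bar> \<partial>lborel)" by (rule integral_abs_bound)
    also have "\<dots> \<le> (\<integral>v. \<bar>\<psi> v\<bar> * (B / \<bar>y\<bar>) \<partial>lborel)"
    proof (rule integral_mono)
      show "integrable lborel (\<lambda>v. \<bar>f v\<bar>)" unfolding f_def
      proof (intro integrable_abs integrable_times[where D = 2])
        fix v show "\<bar>tent ((v - x) / y) - tent (- x / y)\<bar> \<le> 2"
          using tent_nonneg[of "(v - x) / y"] tent_le_2[of "(v - x) / y"] tent_nonneg[of "- x / y"] tent_le_2[of "- x / y"]
          by linarith
      qed measurable
    qed (use integrable fb in auto)
    also have "\<dots> \<le> c * (B / \<bar>y\<bar>)"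
      using mult_right_mono[OF L1, of "B / \<bar>y\<bar>"] B_pos by simp
    finally show ?thesis by (simp add: mult.commute)
  qed
  ultimately have "\<bar>y\<bar> * \<bar>\<integral>a. tent a * \<psi> (x + a * y) \<partial>lborel\<bar> \<le> B * c / \<bar>y\<bar>"
    by (simp add: abs_mult)
  then have "\<bar>\<integral>a. tent a * \<psi> (x + a * y) \<partial>lborel\<bar> \<le> B * c / \<bar>y\<bar> / \<bar>y\<bar>"
    using u by (subst pos_le_divide_eq) (auto simp: mult.commute)
  then show ?thesis by (simp add: power2_eq_square)
qed

text \<open>In the next three lemmas, \<open>(x, y)\<close> is the difference of two points of the plane, and the integral is
the contribution of this pair to the averaged energy. Fubini reduces the decay to the preceding lemma.\<close>

lemma energy_kernel_decay:
  assumes "y \<noteq> 0"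
  shows "\<bar>\<integral>a. tent a * autocorr \<psi> (x + a * y) \<partial>lborel\<bar> \<le> B * c\<^sup>2 / y\<^sup>2"
proof -
  define g where "g u = (\<integral>a. tent a * \<psi> ((u + x) + a * y) \<partial>lborel)" for u
  have gb: "\<bar>g u\<bar> \<le> B * c / y\<^sup>2" for u
    unfolding g_def by (rule tent_average_bound[OF assms])
  have "(\<integral>a. tent a * autocorr \<psi> (x + a * y) \<partial>lborel)
      = (\<integral>a. (\<integral>u. \<psi> u * (tent a * \<psi> (u + (x + a * y))) \<partial>lborel) \<partial>lborel)"
    unfolding autocorr_def by (subst integral_mult_right_zero[symmetric]) (simp add: mult_ac)
  also have "\<dots> = (\<integral>u. (\<integral>a. \<psi> u * (tent a * \<psi> (u + (x + a * y))) \<partial>lborel) \<partial>lborel)"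
    using lborel_pair.Fubini_integral[OF integrable_pair[of x y]] .
  also have "\<dots> = (\<integral>u. \<psi> u * g u \<partial>lborel)" by (simp add: g_def add.assoc)
  finally have eq: "(\<integral>a. tent a * autocorr \<psi> (x + a * y) \<partial>lborel) = (\<integral>u. \<psi> u * g u \<partial>lborel)" .
  have [measurable]: "g \<in> borel_measurable borel"
    unfolding g_def by measurable
  have "\<bar>\<integral>u. \<psi> u * g u \<partial>lborel\<bar> \<le> (\<integral>u. \<bar>\<psi> u * g u\<bar> \<partial>lborel)" by (rule integral_abs_bound)
  also have "\<dots> \<le> (\<integral>u. \<bar>\<psi> u\<bar> * (B * c / y\<^sup>2) \<partial>lborel)"
  proof (rule integral_mono)
    show "integrable lborel (\<lambda>u. \<bar>\<psi> u * g u\<bar>)"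
      using gb by (intro integrable_abs integrable_times) auto
    show "\<bar>\<psi> u * g u\<bar> \<le> \<bar>\<psi> u\<bar> * (B * c / y\<^sup>2)" for u
      unfolding abs_mult using gb by (intro mult_left_mono) auto
  qed (use integrable in auto)
  also have "\<dots> \<le> c * (B * c / y\<^sup>2)"
    using mult_right_mono[OF L1, of "B * c / y\<^sup>2"] B_pos c_nonneg by simp
  finally show ?thesis using eq by (simp add: power2_eq_square mult_ac)
qed

lemma energy_kernel_bound: "\<bar>\<integral>a. tent a * autocorr \<psi> (x + a * y) \<partial>lborel\<bar> \<le> 8 * M * c"
proof -
  have "\<bar>\<integral>a. tent a * autocorr \<psi> (x + a * y) \<partial>lborel\<bar> \<le> (\<integral>a. \<bar>tent a * autocorr \<psi> (x + a * y)\<bar> \<partial>lborel)"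
    by (rule integral_abs_bound)
  also have "\<dots> \<le> (\<integral>a. indicator {-2..2::real} a * (2 * (M * c)) \<partial>lborel)"
  proof (rule integral_mono)
    show "integrable lborel (\<lambda>a. \<bar>tent a * autocorr \<psi> (x + a * y)\<bar>)"
      using integrable_tent_autocorr by (rule integrable_abs)
    show "integrable lborel (\<lambda>a::real. indicator {-2..2} a * (2 * (M * c)))"
      by (intro integrable_mult_left) (auto intro: integrable_real_indicator)
    show "\<bar>tent a * autocorr \<psi> (x + a * y)\<bar> \<le> indicator {-2..2} a * (2 * (M * c))" for a
    proof (cases "a \<in> {-2..2}")
      case True
      have "\<bar>tent a\<bar> * \<bar>autocorr \<psi> (x + a * y)\<bar> \<le> 2 * (M * c)"
        using tent_nonneg[of a] tent_le_2[of a] by (intro mult_mono autocorr_bound) auto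
      then show ?thesis using True by (simp add: abs_mult)
    next
      case False then show ?thesis using tent_eq_0[of a] by (auto simp: abs_if split: if_splits)
    qed
  qed
  also have "\<dots> = 8 * M * c" by simp
  finally show ?thesis .
qed

text \<open>If \<open>(x, y)\<close> is much closer to the first axis than every fibre direction with \<open>\<bar>a\<bar> \<le> 2\<close>, the two points
are never in a common tube. This is why the decay in \<open>y\<close> alone suffices.\<close>

lemma energy_kernel_supp:
  assumes "\<bar>x\<bar> > 2 * \<bar>y\<bar> + 2 * B"
  shows "(\<integral>a. tent a * autocorr \<psi> (x + a * y) \<partial>lborel) = 0"
proof -
  have "tent a * autocorr \<psi> (x + a * y) = 0" for a
  proof (cases "\<bar>a\<bar> > 2")
    case False
    then have "\<bar>a * y\<bar> \<le> 2 * \<bar>y\<bar>" unfolding abs_mult by (intro mult_right_mono) auto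
    then have "\<bar>x + a * y\<bar> > 2 * B" using assms by linarith
    then show ?thesis by (simp add: autocorr_supp)
  qed (simp add: tent_eq_0)
  then show ?thesis by (simp only: integral_zero)
qed

end

definition window :: "real \<Rightarrow> real \<Rightarrow> real" where
  "window h u = (if \<bar>u\<bar> \<le> h then 1 / (2 * h) else 0)"

lemma window_measurable [measurable]: "window h \<in> borel_measurable borel"
  unfolding window_def by measurable

lemma window_integral:
  assumes "h > 0" shows "has_bochner_integral lborel (window h) 1"
proof -
  have "window h = (\<lambda>u. indicator {-h..h} u * (1 / (2 * h)))"
    by (auto simp: window_def indicator_def abs_le_iff fun_eq_iff)
  moreover have "has_bochner_integral lborel (\<lambda>u. indicator {-h..h} u * (1 / (2 * h))) (measure lborel {-h..h} * (1 / (2 * h)))"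
    using assms by (intro has_bochner_integral_mult_left has_bochner_integral_real_indicator) auto
  ultimately show ?thesis using assms by simp
qed

definition band :: "real \<Rightarrow> real \<Rightarrow> real \<Rightarrow> real" where
  "band r R u = window (5 * r) u - window R u"

lemma kernel_band:
  assumes "r > 0" "R \<ge> 5 * r"
  shows "kernel (band r R) (1 / r) R 2"
proof
  have R: "R > 0" using assms by linarith
  have b1: "integrable lborel (window (5 * r))" "(\<integral>u. window (5 * r) u \<partial>lborel) = 1"
    using window_integral[of "5 * r"] assms by (auto simp: has_bochner_integral_iff)
  have b2: "integrable lborel (window R)" "(\<integral>u. window R u \<partial>lborel) = 1"
    using window_integral[of R] R by (auto simp: has_bochner_integral_iff)
  show "band r R \<in> borel_measurable borel" unfolding band_def by measurable
  show "(\<integral>u. band r R u \<partial>lborel) = 0" unfolding band_def using b1 b2 by simp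
  have nn: "0 \<le> window (5 * r) u" "0 \<le> window R u" for u using assms R by (auto simp: window_def)
  have "(\<integral>u. \<bar>band r R u\<bar> \<partial>lborel) \<le> (\<integral>u. window (5 * r) u + window R u \<partial>lborel)"
  proof (rule integral_mono)
    show "\<bar>band r R u\<bar> \<le> window (5 * r) u + window R u" for u using nn[of u] unfolding band_def by linarith
  qed (use b1 b2 in \<open>auto simp: band_def[abs_def]\<close>)
  also have "\<dots> = 2" using b1 b2 by simp
  finally show "(\<integral>u. \<bar>band r R u\<bar> \<partial>lborel) \<le> 2" .
  show "\<bar>band r R u\<bar> \<le> 1 / r" for u
  proof -
    have "window (5 * r) u \<le> 1 / r" using assms by (auto simp: window_def field_simps)
    moreover have "window R u \<le> 1 / r" using assms R by (auto simp: window_def field_simps)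
    ultimately show ?thesis using nn[of u] unfolding band_def by linarith
  qed
  show "\<bar>u\<bar> > R \<Longrightarrow> band r R u = 0" for u using assms by (auto simp: band_def window_def)
qed (use assms in auto)

text \<open>The three estimates combined at the lattice points of mesh \<open>r\<close>. The product form of the quadratic decay makes the sum
over the lattice factorise.\<close>

lemma band_energy_kernel:
  fixes m n :: int and r L :: real
  assumes r: "r > 0" and L: "L \<ge> 5"
  shows "\<bar>\<integral>a. tent a * autocorr (band r (L * r)) (r * m + a * (r * n)) \<partial>lborel\<bar>
    \<le> 16 * L * (3 + 2 * L) / r * (1 / (1 + \<bar>real_of_int m\<bar>) * (1 / (1 + \<bar>real_of_int n\<bar>)))"
proof -
  interpret kernel "band r (L * r)" "1 / r" "L * r" 2
    using r L by (intro kernel_band) auto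
  define I where "I = (\<integral>a. tent a * autocorr (band r (L * r)) (r * m + a * (r * n)) \<partial>lborel)"
  define p where "p = \<bar>real_of_int m\<bar>"
  define q where "q = \<bar>real_of_int n\<bar>"
  have pq: "p \<ge> 0" "q \<ge> 0" by (auto simp: p_def q_def)
  have "\<bar>I\<bar> * ((1 + p) * (1 + q)) \<le> 16 * L * (3 + 2 * L) / r"
  proof (cases "p > 2 * q + 2 * L")
    case True
    have "2 * \<bar>r * n\<bar> + 2 * (L * r) < \<bar>r * m\<bar>"
      using mult_strict_left_mono[OF True r] r by (simp add: p_def q_def abs_mult algebra_simps)
    then have "I = 0" unfolding I_def by (rule energy_kernel_supp)
    then show ?thesis using r L by simp
  next
    case False
    show ?thesis
    proof (cases "n = 0")
      case True
      then have "1 + p \<le> 3 + 2 * L" "q = 0" using False by (auto simp: q_def)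
      moreover have "\<bar>I\<bar> \<le> 16 / r" unfolding I_def using energy_kernel_bound by simp
      ultimately have "\<bar>I\<bar> * ((1 + p) * (1 + q)) \<le> (16 / r) * ((3 + 2 * L) * 1)"
        using pq r by (intro mult_mono) auto
      also have "\<dots> \<le> L * ((16 / r) * ((3 + 2 * L) * 1))" using r L mult_right_mono[of 1 L "(16 / r) * ((3 + 2 * L) * 1)"] by simp
      finally show ?thesis by (simp add: mult_ac)
    next
      case nz: False
      then have q1: "q \<ge> 1" by (simp add: q_def)
      have "\<bar>I\<bar> \<le> L * r * 2\<^sup>2 / (r * n)\<^sup>2" unfolding I_def using nz r by (intro energy_kernel_decay) auto
      also have "\<dots> = 4 * L / (r * q\<^sup>2)" using r by (simp add: power2_eq_square q_def abs_mult[symmetric] field_simps)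
      finally have I: "\<bar>I\<bar> \<le> 4 * L / (r * q\<^sup>2)" .
      have "1 + p \<le> (3 + 2 * L) * q" using False q1 L mult_left_mono[OF q1, of "1 + 2 * L"] by (simp add: algebra_simps)
      moreover have "1 + q \<le> 2 * q" using q1 by simp
      ultimately have "\<bar>I\<bar> * ((1 + p) * (1 + q)) \<le> 4 * L / (r * q\<^sup>2) * (((3 + 2 * L) * q) * (2 * q))"
        using pq r L I by (intro mult_mono) auto
      also have "\<dots> = 8 * L * (3 + 2 * L) / r" using q1 by (simp add: power2_eq_square)
      also have "\<dots> \<le> 16 * L * (3 + 2 * L) / r" using r L by (intro divide_right_mono) auto
      finally show ?thesis .
    qed
  qed
  moreover have "(1 + p) * (1 + q) > 0" using pq by (simp add: add_nonneg_pos)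
  ultimately have "\<bar>I\<bar> \<le> 16 * L * (3 + 2 * L) / r / ((1 + p) * (1 + q))"
    by (subst pos_le_divide_eq)
  then show ?thesis by (simp add: I_def p_def q_def)
qed

section \<open>Energy of a projected grid measure\<close>

definition grid_proj :: "'d \<Rightarrow> 'd \<Rightarrow> real \<Rightarrow> real \<Rightarrow> ('d \<Rightarrow> int) \<Rightarrow> real" where
  "grid_proj i j r a k = r * k i + a * (r * k j)"

definition profile :: "(real \<Rightarrow> real) \<Rightarrow> 'b set \<Rightarrow> ('b \<Rightarrow> real) \<Rightarrow> real \<Rightarrow> real" where
  "profile \<psi> P p u = (\<Sum>k\<in>P. \<psi> (u - p k)) / card P"

definition energy :: "(real \<Rightarrow> real) \<Rightarrow> 'b set \<Rightarrow> ('b \<Rightarrow> real) \<Rightarrow> real" where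
  "energy \<psi> P p = (\<Sum>k\<in>P. \<Sum>k'\<in>P. autocorr \<psi> (p k - p k')) / (card P)\<^sup>2"

context kernel
begin

lemma has_integral_translates:
  "has_bochner_integral lborel (\<lambda>u. \<psi> (u - p) * \<psi> (u - q)) (autocorr \<psi> (p - q))"
proof -
  have "integrable lborel (\<lambda>u. \<psi> u * \<psi> (u + (p - q)))"
    using bound by (intro integrable_times[where D = M]) auto
  from lborel_integrable_real_affine[OF this, of 1 "- p"]
  have "integrable lborel (\<lambda>u. \<psi> (u - p) * \<psi> (u - q))" by (simp add: algebra_simps)
  moreover have "(\<integral>u. \<psi> (u - p) * \<psi> (u - q) \<partial>lborel) = autocorr \<psi> (p - q)"
    unfolding autocorr_def by (subst lborel_integral_real_affine[of 1 _ p]) (auto simp: algebra_simps)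
  ultimately show ?thesis by (simp add: has_bochner_integral_iff)
qed

text \<open>The energy is defined as a sum over pairs, which is the form in which it can be averaged over slopes;
it is used through its second form, a squared \<open>L\<^sup>2\<close> norm.\<close>

lemma energy_eq_integral:
  "has_bochner_integral lborel (\<lambda>u. (profile \<psi> P p u)\<^sup>2) (energy \<psi> P p)"
proof -
  have "(profile \<psi> P p u)\<^sup>2 = (\<Sum>k\<in>P. \<Sum>k'\<in>P. \<psi> (u - p k) * \<psi> (u - p k')) / (card P)\<^sup>2" for u
    by (simp add: profile_def power2_eq_square sum_product)
  then show ?thesis unfolding energy_def
    by (simp only: divide_inverse)
       (intro has_bochner_integral_mult_left has_bochner_integral_sum has_integral_translates)
qed

lemma tent_energy_expand:
  "(\<lambda>a. tent a * energy \<psi> P (grid_proj i j r a)) = (\<lambda>a. (\<Sum>k\<in>P. \<Sum>k'\<in>P.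
      tent a * autocorr \<psi> (r * (k i - k' i) + a * (r * (k j - k' j)))) / (card P)\<^sup>2)"
  unfolding energy_def grid_proj_def by (auto simp: sum_distrib_left algebra_simps)

lemma integrable_tent_energy:
  "integrable lborel (\<lambda>a. tent a * energy \<psi> P (grid_proj i j r a))"
  unfolding tent_energy_expand divide_inverse
  by (intro integrable_mult_left Bochner_Integration.integrable_sum integrable_tent_autocorr)

lemma integral_tent_energy:
  "(\<integral>a. tent a * energy \<psi> P (grid_proj i j r a) \<partial>lborel) = (\<Sum>k\<in>P. \<Sum>k'\<in>P.
     \<integral>a. tent a * autocorr \<psi> (r * (k i - k' i) + a * (r * (k j - k' j))) \<partial>lborel) / (card P)\<^sup>2"
  unfolding tent_energy_expand
  by (simp add: Bochner_Integration.integral_sum integrable_tent_autocorr)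

end

lemma sum_inverse_le_ln:
  "(\<Sum>m\<in>{- int M..int M}. 1 / (1 + \<bar>real_of_int m\<bar>)) \<le> 2 * (1 + ln (1 + real M))"
proof (induction M)
  case (Suc M)
  have split: "{- int (Suc M)..int (Suc M)} = insert (- int (Suc M)) (insert (int (Suc M)) {- int M..int M})"
    by auto
  have "(\<Sum>m\<in>{- int (Suc M)..int (Suc M)}. 1 / (1 + \<bar>real_of_int m\<bar>))
      = 2 / (real M + 2) + (\<Sum>m\<in>{- int M..int M}. 1 / (1 + \<bar>real_of_int m\<bar>))"
    unfolding split by (subst sum.insert, simp, simp)+ (simp add: field_simps)
  moreover have "1 / (real M + 2) \<le> ln (real M + 2) - ln (real M + 1)"
  proof -
    have "ln ((real M + 1) / (real M + 2)) \<le> (real M + 1) / (real M + 2) - 1"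
      by (intro ln_le_minus_one) auto
    also have "\<dots> = - (1 / (real M + 2))" by (simp add: field_simps)
    finally show ?thesis by (simp add: ln_div)
  qed
  ultimately show ?case using Suc by (simp add: algebra_simps)
qed simp

lemma sum_inverse_le_powr:
  assumes "\<epsilon> > 0"
  shows "(\<Sum>m\<in>{- int M..int M}. 1 / (1 + \<bar>real_of_int m\<bar>)) \<le> 2 * (1 + 1 / \<epsilon>) * (1 + real M) powr \<epsilon>"
proof -
  have "ln (1 + real M) \<le> (1 + real M) powr \<epsilon> / \<epsilon>" using assms by (intro ln_powr_bound) auto
  moreover have "1 \<le> (1 + real M) powr \<epsilon>" using assms by (intro ge_one_powr_ge_zero) auto
  ultimately show ?thesis using sum_inverse_le_ln[of M] by (simp add: algebra_simps)
qed

lemma planar_lattice_sum: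
  fixes P :: "(2 \<Rightarrow> int) set" and i j :: 2
  assumes ij: "i \<noteq> j" and fin: "finite P"
    and M: "\<And>k'. k' \<in> P \<Longrightarrow> \<bar>k i - k' i\<bar> \<le> int M \<and> \<bar>k j - k' j\<bar> \<le> int M"
  shows "(\<Sum>k'\<in>P. 1 / (1 + \<bar>real_of_int (k i - k' i)\<bar>) * (1 / (1 + \<bar>real_of_int (k j - k' j)\<bar>)))
     \<le> (\<Sum>m\<in>{- int M..int M}. 1 / (1 + \<bar>real_of_int m\<bar>))\<^sup>2"
proof -
  define h where "h m = 1 / (1 + \<bar>real_of_int m\<bar>)" for m
  define g where "g k' = (k i - k' i, k j - k' j)" for k' :: "2 \<Rightarrow> int"
  have "x = i \<or> x = j" for x :: 2 using ij exhaust_2[of x] exhaust_2[of i] exhaust_2[of j] by auto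
  then have inj: "inj_on g P" unfolding inj_on_def g_def by (auto simp: fun_eq_iff) metis
  have "(\<Sum>k'\<in>P. h (k i - k' i) * h (k j - k' j)) = (\<Sum>p\<in>g ` P. h (fst p) * h (snd p))"
    by (subst sum.reindex[OF inj]) (simp add: g_def)
  also have "\<dots> \<le> (\<Sum>p\<in>{- int M..int M} \<times> {- int M..int M}. h (fst p) * h (snd p))"
    using M by (intro sum_mono2) (force simp: g_def abs_le_iff h_def)+
  also have "\<dots> = (\<Sum>m\<in>{- int M..int M}. h m)\<^sup>2"
    by (simp add: power2_eq_square sum_product sum.cartesian_product split_def)
  finally show ?thesis by (simp add: h_def)
qed

text \<open>For each cube, the sum over all cubes of the quadratically decaying kernel is at most the square of a harmonic
sum of length \<open>O(1/r)\<close>, which costs the factor \<open>r powr (-\<epsilon>)\<close>.\<close>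

lemma average_energy_bound:
  fixes K :: "(real^2) set" and i j :: 2
  assumes K: "bounded K" "K \<noteq> {}" and ij: "i \<noteq> j" and L: "L \<ge> 5" and \<epsilon>: "\<epsilon> > 0"
  obtains C where "C > 0" and "\<And>r. 0 < r \<Longrightarrow> r \<le> 1 \<Longrightarrow>
     (\<integral>a. tent a * energy (band r (L * r)) (cube_index r ` K) (grid_proj i j r a) \<partial>lborel)
        \<le> C * r powr (- 1 - \<epsilon>) / card (cube_index r ` K)"
proof -
  obtain B where B: "\<And>x. x \<in> K \<Longrightarrow> norm x \<le> B" "B > 0" using K(1) unfolding bounded_pos by blast
  define D where "D = 2 * B + 4"
  define C where "C = 16 * L * (3 + 2 * L) * (2 * (1 + 1 / (\<epsilon> / 2)) * D powr (\<epsilon> / 2))\<^sup>2"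
  have pos: "2 * (1 + 1 / (\<epsilon> / 2)) * D powr (\<epsilon> / 2) > 0"
    using \<epsilon> B(2) by (intro mult_pos_pos) (auto simp: D_def add_pos_pos)
  have "C > 0" unfolding C_def
    by (intro mult_pos_pos[OF _ zero_less_power[OF pos]]) (use L in auto)
  moreover have "(\<integral>a. tent a * energy (band r (L * r)) (cube_index r ` K) (grid_proj i j r a) \<partial>lborel)
        \<le> C * r powr (- 1 - \<epsilon>) / card (cube_index r ` K)" if r: "0 < r" "r \<le> 1" for r
  proof -
    interpret kernel "band r (L * r)" "1 / r" "L * r" 2
      using r L by (intro kernel_band) auto
    define P where "P = cube_index r ` K"
    have fin: "finite P" unfolding P_def using finite_cube_index K(1) r(1) by blast
    have cP: "card P > 0" using fin K(2) by (simp add: P_def card_gt_0_iff)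
    define M where "M = nat \<lceil>2 * B / r + 2\<rceil>"
    have M: "\<bar>k i - k' i\<bar> \<le> int M" if "k \<in> P" "k' \<in> P" for k k' and i :: 2
    proof -
      from that obtain x y where x: "x \<in> K" "k = cube_index r x" and y: "y \<in> K" "k' = cube_index r y"
        unfolding P_def by blast
      have "\<bar>r * k i - r * k' i\<bar> \<le> 2 * B + 2 * r"
        using cube_index_component_dist[OF r(1), of x i] cube_index_component_dist[OF r(1), of y i]
          component_le_norm_cart[of x i] component_le_norm_cart[of y i] B(1)[OF x(1)] B(1)[OF y(1)]
        unfolding x(2) y(2) by linarith
      then have "r * \<bar>real_of_int (k i - k' i)\<bar> \<le> 2 * B + 2 * r"
        using r(1) by (simp only: of_int_diff right_diff_distrib[symmetric] abs_mult abs_of_pos)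
      then have "\<bar>real_of_int (k i - k' i)\<bar> \<le> (2 * B + 2 * r) / r"
        using r(1) by (simp only: pos_le_divide_eq mult.commute)
      also have "\<dots> = 2 * B / r + 2" using r(1) by (simp add: add_divide_distrib)
      finally have "\<bar>real_of_int (k i - k' i)\<bar> \<le> 2 * B / r + 2" .
      then show ?thesis unfolding M_def by linarith
    qed
    have "real M \<le> 2 * B / r + 3" 
    proof -
      have "0 \<le> 2 * B / r" using B(2) r by simp
      then show ?thesis unfolding M_def by linarith
    qed
    then have "1 + real M \<le> 2 * B / r + 4" by simp
    also have "\<dots> \<le> D / r" using r by (simp add: D_def field_simps)
    finally have M': "1 + real M \<le> D / r" .
    define S where "S = (\<Sum>m\<in>{- int M..int M}. 1 / (1 + \<bar>real_of_int m\<bar>))"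
    have S0: "S \<ge> 0" unfolding S_def by (intro sum_nonneg) auto
    have "S \<le> 2 * (1 + 1 / (\<epsilon> / 2)) * (1 + real M) powr (\<epsilon> / 2)"
      unfolding S_def using \<epsilon> by (intro sum_inverse_le_powr) auto
    also have "\<dots> \<le> 2 * (1 + 1 / (\<epsilon> / 2)) * (D / r) powr (\<epsilon> / 2)"
      using \<epsilon> M' by (intro mult_left_mono powr_mono2) auto
    also have "\<dots> = 2 * (1 + 1 / (\<epsilon> / 2)) * D powr (\<epsilon> / 2) * r powr (- (\<epsilon> / 2))"
      using r B(2) by (simp add: powr_divide powr_minus_divide D_def)
    finally have "S\<^sup>2 \<le> (2 * (1 + 1 / (\<epsilon> / 2)) * D powr (\<epsilon> / 2) * r powr (- (\<epsilon> / 2)))\<^sup>2"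
      using S0 by (intro power_mono) auto
    also have "\<dots> = (2 * (1 + 1 / (\<epsilon> / 2)) * D powr (\<epsilon> / 2))\<^sup>2 * r powr (- \<epsilon>)"
      using r by (simp add: power_mult_distrib powr_power)
    finally have S2: "S\<^sup>2 \<le> (2 * (1 + 1 / (\<epsilon> / 2)) * D powr (\<epsilon> / 2))\<^sup>2 * r powr (- \<epsilon>)" .
    define A where "A = 16 * L * (3 + 2 * L) / r"
    have A: "A \<ge> 0" using L r by (simp add: A_def)
    have "(\<Sum>k\<in>P. \<Sum>k'\<in>P. \<integral>a. tent a * autocorr (band r (L * r)) (r * (k i - k' i) + a * (r * (k j - k' j))) \<partial>lborel)
      \<le> (\<Sum>k\<in>P. \<Sum>k'\<in>P. A * (1 / (1 + \<bar>real_of_int (k i - k' i)\<bar>) * (1 / (1 + \<bar>real_of_int (k j - k' j)\<bar>))))"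
      unfolding A_def by (intro sum_mono order_trans[OF abs_ge_self band_energy_kernel] r L)
    also have "\<dots> = (\<Sum>k\<in>P. A * (\<Sum>k'\<in>P. 1 / (1 + \<bar>real_of_int (k i - k' i)\<bar>) * (1 / (1 + \<bar>real_of_int (k j - k' j)\<bar>))))"
      by (simp only: sum_distrib_left)
    also have "\<dots> \<le> (\<Sum>k\<in>P. A * S\<^sup>2)"
      unfolding S_def using M by (intro sum_mono mult_left_mono planar_lattice_sum ij fin A) blast+
    also have "\<dots> = card P * (A * S\<^sup>2)" by simp
    also have "\<dots> \<le> card P * (A * ((2 * (1 + 1 / (\<epsilon> / 2)) * D powr (\<epsilon> / 2))\<^sup>2 * r powr (- \<epsilon>)))"
      by (intro mult_left_mono S2 A) auto
    also have "\<dots> = card P * (C * (r powr (- \<epsilon>) / r))" by (simp add: A_def C_def mult_ac)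
    also have "r powr (- \<epsilon>) / r = r powr (- 1 - \<epsilon>)" using r by (simp add: powr_diff powr_minus_divide field_simps)
    finally have "(\<integral>a. tent a * energy (band r (L * r)) P (grid_proj i j r a) \<partial>lborel)
      \<le> card P * (C * r powr (- 1 - \<epsilon>)) / (card P)\<^sup>2"
      unfolding integral_tent_energy by (intro divide_right_mono) auto
    also have "\<dots> = C * r powr (- 1 - \<epsilon>) / card P" using cP by (simp add: power2_eq_square)
    finally show ?thesis by (simp add: P_def)
  qed
  ultimately show ?thesis by (rule that)
qed

section \<open>Dense tubes and the energy\<close>

definition shear :: "'d \<Rightarrow> 'd \<Rightarrow> real \<Rightarrow> real^'d \<Rightarrow> real" where
  "shear i j a x = x $ i + a * x $ j"

text \<open>The radius \<open>4 * r\<close> leaves room for two errors: a point of \<open>K\<close> and the corner of its cube have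
projections differing by up to \<open>2 * r\<close>, and densities have to be compared at two different scales.\<close>

definition tube_density :: "'d \<Rightarrow> 'd \<Rightarrow> real \<Rightarrow> (real^'d) set \<Rightarrow> real \<Rightarrow> real^'d \<Rightarrow> real" where
  "tube_density i j a K r z =
     real (card {k \<in> cube_index r ` K. \<bar>grid_proj i j r a k - shear i j a z\<bar> \<le> 4 * r})
       / (real (card (cube_index r ` K)) * r)"

lemma grid_proj_close:
  assumes "r > 0" "\<bar>a\<bar> \<le> 1"
  shows "\<bar>grid_proj i j r a (cube_index r x) - shear i j a x\<bar> \<le> 2 * r"
proof -
  have "\<bar>a * (r * cube_index r x j - x $ j)\<bar> \<le> 1 * r"
    unfolding abs_mult using assms cube_index_component_dist[OF assms(1), of x j]
    by (intro mult_mono) (auto simp: abs_minus_commute)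
  then show ?thesis
    using cube_index_component_dist[OF assms(1), of x i]
    unfolding grid_proj_def shear_def by (simp add: right_diff_distrib abs_le_iff)
qed

text \<open>Sub-uniform distribution applied to the part of \<open>K\<close> inside a tube of width about \<open>R\<close>: the measure of
scale \<open>r\<close> gives this tube at most \<open>C\<close> times the mass that the measure of scale \<open>R\<close> gives a slightly wider one.\<close>

lemma tube_count_coarse:
  fixes C :: real
  assumes K: "bounded K" and C: "sub_uniform_const C K" "C \<ge> 0"
    and r: "r \<in> dyadic" "R \<in> dyadic" "4 * r \<le> R" and a: "\<bar>a\<bar> \<le> 1"
    and u: "\<bar>u - shear i j a z\<bar> \<le> r" and z: "z \<in> K"
  shows "card {k \<in> cube_index r ` K. \<bar>u - grid_proj i j r a k\<bar> \<le> R}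
    \<le> C * card (cube_index r ` K) * tube_density i j a K R z * R"
proof -
  have pos: "r > 0" "R > 0" using r dyadic_pos by auto
  define N where "N = real (card (cube_index r ` K))"
  define N' where "N' = real (card (cube_index R ` K))"
  have fin: "finite (cube_index s ` X)" if "X \<subseteq> K" "s > 0" for X s
    using finite_cube_index bounded_subset[OF K that(1)] that(2) by blast
  have N': "N' > 0" using fin[of K R] pos z by (auto simp: N'_def card_gt_0_iff)
  define X where "X = {x\<in>K. \<bar>shear i j a x - shear i j a z\<bar> \<le> R + 3 * r}"
  define Q where "Q = {k \<in> cube_index R ` K. \<bar>grid_proj i j R a k - shear i j a z\<bar> \<le> 4 * R}"
  have X: "X \<subseteq> K" by (auto simp: X_def)
  have "{k \<in> cube_index r ` K. \<bar>u - grid_proj i j r a k\<bar> \<le> R} \<subseteq> cube_index r ` X"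
  proof clarify
    fix x assume x: "x \<in> K" "\<bar>u - grid_proj i j r a (cube_index r x)\<bar> \<le> R"
    then have "x \<in> X" using grid_proj_close[OF pos(1) a, of i j x] u by (simp add: X_def)
    then show "cube_index r x \<in> cube_index r ` X" by blast
  qed
  then have 1: "card {k \<in> cube_index r ` K. \<bar>u - grid_proj i j r a k\<bar> \<le> R} \<le> card (cube_index r ` X)"
    by (intro card_mono fin X pos)
  have "cube_index R ` X \<subseteq> Q"
  proof clarify
    fix x assume x: "x \<in> X"
    then have "\<bar>grid_proj i j R a (cube_index R x) - shear i j a z\<bar> \<le> 4 * R"
      using grid_proj_close[OF pos(2) a, of i j x] r(3) unfolding X_def mem_Collect_eq by linarith
    then show "cube_index R x \<in> Q" using x by (auto simp: Q_def X_def)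
  qed
  then have 2: "card (cube_index R ` X) \<le> card Q"
    by (intro card_mono finite_subset[OF _ fin[OF order_refl pos(2)]]) (auto simp: Q_def)
  have "N' * card (cube_index r ` X) \<le> C * N * card (cube_index R ` X)"
    using C(1) r pos X unfolding sub_uniform_const_def N_def N'_def by auto
  also have "\<dots> \<le> C * N * card Q" using 2 C(2) by (intro mult_left_mono) (auto simp: N_def)
  also have "\<dots> = N' * (C * N * tube_density i j a K R z * R)"
    using N' pos by (simp add: tube_density_def Q_def N'_def)
  finally have "card (cube_index r ` X) \<le> C * N * tube_density i j a K R z * R" using N' by simp
  then show ?thesis using 1 by (simp add: N_def)
qed

lemma has_integral_window_translate:
  assumes "h > 0" shows "has_bochner_integral lborel (\<lambda>u. window h (u - p)) 1"
proof -
  have "has_bochner_integral lborel (\<lambda>u. window h (- p + 1 * u)) (1 /\<^sub>R \<bar>1\<bar>)"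
    using window_integral[OF assms] lborel_has_bochner_integral_real_affine_iff[of 1 "window h" 1 "- p"]
    by simp
  then show ?thesis by (simp add: algebra_simps)
qed

lemma sum_window:
  "(\<Sum>k\<in>P. window h (u - p k)) = (if finite P then card {k\<in>P. \<bar>u - p k\<bar> \<le> h} / (2 * h) else 0)"
  by (simp add: window_def sum.If_cases Int_def)

text \<open>Chebyshev's inequality. Near the projection of a point \<open>z\<close> of \<open>V\<close> the projected measure, averaged over
the window of radius \<open>5 * r\<close>, is at least a tenth of the density; averaged over the window of radius \<open>R\<close> it is
at most half as large, by the assumption on the density at scale \<open>R\<close>. So the band-pass profile \<open>F\<close> is comparable to the density
there. The number of cubes above a point of the line is controlled by the density, hence by \<open>F\<close>, hence by
\<open>F\<^sup>2 / \<tau>\<close>; integrating over the line gives the claim.\<close>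

lemma dense_cubes_le_energy:
  fixes K V :: "(real^2) set"
  assumes K: "bounded K" and C: "sub_uniform_const C K" "C > 0"
    and r: "r \<in> dyadic" "R \<in> dyadic" "5 * r \<le> R" and a: "\<bar>a\<bar> \<le> 1" and \<tau>: "\<tau> > 0"
    and V: "V \<subseteq> K" "\<And>z. z \<in> V \<Longrightarrow> \<tau> \<le> tube_density i j a K r z"
      "\<And>z. z \<in> V \<Longrightarrow> 10 * C * tube_density i j a K R z \<le> tube_density i j a K r z"
  shows "card (cube_index r ` V) \<le> 200 * card (cube_index r ` K) / \<tau> *
      energy (band r R) (cube_index r ` K) (grid_proj i j r a)"
proof -
  have pos: "r > 0" "R > 0" using r dyadic_pos by auto
  define P where "P = cube_index r ` K"
  define p where "p = grid_proj i j r a"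
  define F where "F = profile (band r R) P p"
  interpret kernel "band r R" "1 / r" R 2 using pos r by (intro kernel_band) auto
  have finP: "finite P" unfolding P_def using finite_cube_index K pos by blast
  have E: "has_bochner_integral lborel (\<lambda>u. (F u)\<^sup>2) (energy (band r R) P p)"
    unfolding F_def by (rule energy_eq_integral)
  define W where "W = cube_index r ` V"
  have W: "W \<subseteq> P" using V(1) by (auto simp: W_def P_def)
  have finW: "finite W" using W finP by (rule finite_subset)
  define c where "c k = (SOME z. z \<in> V \<and> cube_index r z = k)" for k
  have c: "c k \<in> V" "cube_index r (c k) = k" if "k \<in> W" for k
    using that someI_ex[of "\<lambda>z. z \<in> V \<and> cube_index r z = k"] unfolding W_def c_def by auto
  define q where "q k = shear i j a (c k)" for k
  have pq: "\<bar>p k - q k\<bar> \<le> 2 * r" if "k \<in> W" for k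
    using grid_proj_close[OF pos(1) a, of i j "c k"] c[OF that] by (simp add: p_def q_def)
  \<comment> \<open>The left-hand side integrates to the number of cubes in \<open>W\<close>.\<close>
  have pw: "(\<Sum>k\<in>W. window r (u - q k)) \<le> 200 * card P / \<tau> * (F u)\<^sup>2" for u
  proof (cases "\<exists>k\<in>W. \<bar>u - q k\<bar> \<le> r")
    case False
    then have "(\<Sum>k\<in>W. window r (u - q k)) = 0" by (intro sum.neutral) (auto simp: window_def)
    then show ?thesis using \<tau> by simp
  next
    case True
    then obtain k0 where k0: "k0 \<in> W" "\<bar>u - q k0\<bar> \<le> r" by blast
    define z where "z = c k0"
    define D where "D = tube_density i j a K r z"
    have z: "z \<in> V" "z \<in> K" "\<bar>u - shear i j a z\<bar> \<le> r" using c k0 V(1) by (auto simp: z_def q_def)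
    have cP: "card P > 0" using finP z by (auto simp: P_def card_gt_0_iff)
    define A1 where "A1 = (\<Sum>k\<in>P. window (5 * r) (u - p k)) / card P"
    define A2 where "A2 = (\<Sum>k\<in>P. window R (u - p k)) / card P"
    have F: "F u = A1 - A2"
      by (simp add: F_def profile_def band_def A1_def A2_def sum_subtractf diff_divide_distrib)
    have A1: "A1 = card {k\<in>P. \<bar>u - p k\<bar> \<le> 5 * r} / (10 * r) / card P"
      using finP by (simp add: A1_def sum_window)
    have "card {k\<in>P. \<bar>p k - shear i j a z\<bar> \<le> 4 * r} \<le> card {k\<in>P. \<bar>u - p k\<bar> \<le> 5 * r}"
      using finP z(3) by (intro card_mono) auto
    then have "D * (card P * r) \<le> card {k\<in>P. \<bar>u - p k\<bar> \<le> 5 * r}"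
      using cP pos by (simp add: D_def tube_density_def P_def p_def)
    then have A1D: "D / 10 \<le> A1" using cP pos unfolding A1 by (simp add: field_simps)
    have "card {k\<in>P. \<bar>u - p k\<bar> \<le> R} \<le> C * card P * tube_density i j a K R z * R"
      unfolding P_def p_def using C r pos by (intro tube_count_coarse[OF K C(1) _ r(1,2) _ a z(3,2)]) auto
    then have "A2 \<le> C * tube_density i j a K R z / 2"
      using cP pos finP by (simp add: A2_def sum_window field_simps)
    also have "\<dots> \<le> D / 20" using V(3)[OF z(1)] by (simp add: D_def)
    finally have A2: "A2 \<le> A1 / 2" using A1D by simp
    have FA: "A1 \<le> 2 * F u" using A2 F by simp
    have F\<tau>: "\<tau> \<le> 20 * F u" using A1D FA V(2)[OF z(1)] by (simp add: D_def)
    have "{k\<in>W. \<bar>u - q k\<bar> \<le> r} \<subseteq> {k\<in>P. \<bar>u - p k\<bar> \<le> 5 * r}" using W pq by force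
    then have "card {k\<in>W. \<bar>u - q k\<bar> \<le> r} \<le> card {k\<in>P. \<bar>u - p k\<bar> \<le> 5 * r}"
      using finP by (intro card_mono) auto
    then have "(\<Sum>k\<in>W. window r (u - q k)) \<le> card {k\<in>P. \<bar>u - p k\<bar> \<le> 5 * r} / (2 * r)"
      using finW pos by (simp add: sum_window divide_right_mono)
    also have "\<dots> = 5 * card P * A1" using cP pos by (simp add: A1 field_simps)
    also have "\<dots> \<le> 5 * card P * (2 * F u)" using FA by (intro mult_left_mono) auto
    also have "\<dots> \<le> 5 * card P * (2 * F u) * (20 * F u / \<tau>)"
    proof -
      have "5 * card P * (2 * F u) * 1 \<le> 5 * card P * (2 * F u) * (20 * F u / \<tau>)"
        using F\<tau> \<tau> by (intro mult_left_mono mult_nonneg_nonneg) auto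
      then show ?thesis by simp
    qed
    also have "\<dots> = 200 * card P / \<tau> * (F u)\<^sup>2" by (simp add: power2_eq_square)
    finally show ?thesis .
  qed
  have S: "has_bochner_integral lborel (\<lambda>u. \<Sum>k\<in>W. window r (u - q k)) (\<Sum>k\<in>W. 1)"
    using pos by (intro has_bochner_integral_sum has_integral_window_translate)
  have "real (card W) = (\<integral>u. (\<Sum>k\<in>W. window r (u - q k)) \<partial>lborel)"
    using S by (simp add: has_bochner_integral_iff)
  also have "\<dots> \<le> (\<integral>u. 200 * card P / \<tau> * (F u)\<^sup>2 \<partial>lborel)"
    using S E pw by (intro integral_mono) (auto simp: has_bochner_integral_iff)
  also have "\<dots> = 200 * card P / \<tau> * energy (band r R) P p"
    using E by (simp add: has_bochner_integral_iff)
  finally show ?thesis by (simp add: W_def P_def p_def)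
qed

section \<open>Critical scales and heavy slices for almost every slope\<close>

lemma tube_density_le:
  fixes K :: "(real^2) set"
  assumes "bounded K" "r > 0"
  shows "tube_density i j a K r z \<le> 1 / r"
proof -
  have fin: "finite (cube_index r ` K)" using finite_cube_index assms by blast
  have "card {k \<in> cube_index r ` K. \<bar>grid_proj i j r a k - shear i j a z\<bar> \<le> 4 * r} \<le> card (cube_index r ` K)"
    using fin by (intro card_mono) auto
  then show ?thesis using assms(2) by (cases "card (cube_index r ` K) = 0") (simp_all add: tube_density_def field_simps)
qed

text \<open>A density above \<open>A * r powr (-2 * \<epsilon>)\<close> is impossible for \<open>r \<ge> 1\<close>, since densities are at most \<open>1 / r\<close>.
So among the scales \<open>(1/2) ^ n * L ^ k\<close> at which it occurs there is a largest one.\<close>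

lemma critical_scale:
  fixes K :: "(real^2) set"
  assumes K: "bounded K" and L: "L \<ge> 2" and \<epsilon>: "0 < \<epsilon>" "2 * \<epsilon> \<le> 1" and A: "A > 1"
    and start: "A * ((1/2) ^ n) powr (- 2 * \<epsilon>) \<le> tube_density i j a K ((1/2) ^ n) z"
  obtains k where "k \<le> n" "(1/2) ^ n * L ^ k < 1"
    "A * ((1/2) ^ n * L ^ k) powr (- 2 * \<epsilon>) \<le> tube_density i j a K ((1/2) ^ n * L ^ k) z"
    "tube_density i j a K ((1/2) ^ n * L ^ Suc k) z < A * ((1/2) ^ n * L ^ Suc k) powr (- 2 * \<epsilon>)"
proof -
  define r where "r k = (1/2) ^ n * L ^ k" for k
  have r: "r k > 0" for k using L by (simp add: r_def)
  define S where "S = {k. A * r k powr (- 2 * \<epsilon>) \<le> tube_density i j a K (r k) z}"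
  have small: "r k < 1" if "k \<in> S" for k
  proof (rule ccontr)
    assume "\<not> r k < 1"
    then have "r k powr (- 1) \<le> r k powr (- 2 * \<epsilon>)" using \<epsilon> by (intro powr_mono) auto
    then have "1 / r k \<le> r k powr (- 2 * \<epsilon>)" using r[of k] by (simp add: powr_minus_divide)
    also have "\<dots> < A * r k powr (- 2 * \<epsilon>)" using A r[of k] by simp
    also have "\<dots> \<le> tube_density i j a K (r k) z" using that by (simp add: S_def)
    finally show False using tube_density_le[OF K r, of i j a k z] by simp
  qed
  have le: "k \<le> n" if "k \<in> S" for k
  proof -
    have "(2::real) ^ k \<le> L ^ k" using L by (intro power_mono) auto
    then have "(1/2) ^ n * 2 ^ k \<le> r k" by (simp add: r_def)
    then have "(1/2) ^ n * (2::real) ^ k < 1" using small[OF that] by simp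
    then have "(2::real) ^ k < 2 ^ n" by (simp add: power_one_over field_simps)
    then show ?thesis by simp
  qed
  then have fin: "finite S" by (meson finite_nat_set_iff_bounded_le)
  have "0 \<in> S" using start by (simp add: S_def r_def)
  define k where "k = Max S"
  have "k \<in> S" unfolding k_def using fin \<open>0 \<in> S\<close> by (intro Max_in) auto
  moreover have "Suc k \<notin> S" using Max_ge[OF fin, of "Suc k"] unfolding k_def by fastforce
  ultimately show ?thesis
    using that[of k] small le by (auto simp: S_def r_def not_le)
qed

definition scales :: "real \<Rightarrow> nat \<Rightarrow> nat set" where
  "scales L n = {k. k \<le> n \<and> (1/2) ^ n * L ^ k < 1}"

text \<open>The bound of \<open>dense_cubes_le_energy\<close>, with the density threshold \<open>\<tau> = A * r powr (-2 * \<epsilon>)\<close> and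
\<open>A = ((1/2) ^ n) powr (-\<beta>)\<close>, weighted by \<open>r powr w\<close> and summed over the possible critical scales. Unlike
the number of cubes that are needed, it is visibly measurable in the slope.\<close>

definition cover_cost ::
    "2 \<Rightarrow> 2 \<Rightarrow> (real^2) set \<Rightarrow> real \<Rightarrow> real \<Rightarrow> real \<Rightarrow> real \<Rightarrow> nat \<Rightarrow> real \<Rightarrow> real" where
  "cover_cost i j K L \<epsilon> \<beta> w n a = (\<Sum>k\<in>scales L n. let r = (1/2) ^ n * L ^ k in
     r powr w * (200 * card (cube_index r ` K) / (((1/2) ^ n) powr (- \<beta>) * r powr (- 2 * \<epsilon>))
       * energy (band r (L * r)) (cube_index r ` K) (grid_proj i j r a)))"

lemma finite_scales [simp]: "finite (scales L n)"
  by (simp add: scales_def)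

lemma energy_band_nonneg:
  assumes "r > 0" "L \<ge> 5"
  shows "0 \<le> energy (band r (L * r)) P p"
proof -
  interpret kernel "band r (L * r)" "1 / r" "L * r" 2 using assms by (intro kernel_band) auto
  have "energy (band r (L * r)) P p = (\<integral>u. (profile (band r (L * r)) P p u)\<^sup>2 \<partial>lborel)"
    using energy_eq_integral[of P p] by (simp add: has_bochner_integral_iff)
  then show ?thesis by simp
qed

lemma cover_cost_nonneg:
  assumes "L \<ge> 5" shows "0 \<le> cover_cost i j K L \<epsilon> \<beta> w n a"
  unfolding cover_cost_def Let_def using assms
  by (intro sum_nonneg mult_nonneg_nonneg divide_nonneg_nonneg energy_band_nonneg) auto

text \<open>Sort the points of \<open>H\<close> by critical scale \<open>r\<close> and cover each class by the \<open>r\<close>-cubes that meet it.\<close>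

lemma dense_points_cover:
  fixes K :: "(real^2) set"
  assumes K: "bounded K" and C: "sub_uniform_const C K" "C > 0"
    and L: "L = 2 ^ l" "L \<ge> 5" "10 * C \<le> L powr (2 * \<epsilon>)"
    and \<epsilon>: "0 < \<epsilon>" "2 * \<epsilon> \<le> 1" and \<beta>: "\<beta> > 0" and n: "n > 0" and a: "\<bar>a\<bar> \<le> 1"
    and H: "H \<subseteq> K" "\<And>z. z \<in> H \<Longrightarrow> ((1/2) ^ n) powr (- \<beta> - 2 * \<epsilon>) \<le> tube_density i j a K ((1/2) ^ n) z"
  obtains \<J> :: "(nat \<times> (2 \<Rightarrow> int)) set" and D d where "finite \<J>" "H \<subseteq> (\<Union>J\<in>\<J>. D J)"
    "\<And>J. J \<in> \<J> \<Longrightarrow> bounded (D J) \<and> diameter (D J) \<le> d J"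
    "(\<Sum>J\<in>\<J>. d J powr w) \<le> 2 powr w * cover_cost i j K L \<epsilon> \<beta> w n a"
proof -
  define \<delta> :: real where "\<delta> = (1/2) ^ n"
  define A where "A = \<delta> powr (- \<beta>)"
  define r where "r k = \<delta> * L ^ k" for k
  have \<delta>: "0 < \<delta>" "\<delta> < 1" using n by (auto simp: \<delta>_def power_less_one_iff)
  have A: "A > 1" unfolding A_def using \<delta> \<beta> powr_less_mono2_neg[of "- \<beta>" \<delta> 1] by simp
  have r: "r k > 0" for k using L \<delta> by (simp add: r_def)
  have rd: "r k \<in> dyadic" for k
    unfolding r_def \<delta>_def L(1) power_mult[symmetric] by (intro dyadic_mult_power half_power_dyadic)
  define V where "V k = {z\<in>H. A * r k powr (- 2 * \<epsilon>) \<le> tube_density i j a K (r k) z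
      \<and> tube_density i j a K (r (Suc k)) z < A * r (Suc k) powr (- 2 * \<epsilon>)}" for k
  have HV: "\<exists>k\<in>scales L n. z \<in> V k" if z: "z \<in> H" for z
  proof -
    have "A * \<delta> powr (- 2 * \<epsilon>) \<le> tube_density i j a K \<delta> z"
      using H(2)[OF z] \<delta> by (simp add: A_def \<delta>_def flip: powr_add)
    then obtain k where "k \<le> n" "\<delta> * L ^ k < 1"
        "A * (\<delta> * L ^ k) powr (- 2 * \<epsilon>) \<le> tube_density i j a K (\<delta> * L ^ k) z"
        "tube_density i j a K (\<delta> * L ^ Suc k) z < A * (\<delta> * L ^ Suc k) powr (- 2 * \<epsilon>)"
      using critical_scale[OF K _ \<epsilon> A, of L n i j a z] L unfolding \<delta>_def by auto
    then show ?thesis using z by (auto simp: V_def scales_def r_def \<delta>_def)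
  qed
  have count: "card (cube_index (r k) ` V k) \<le> 200 * card (cube_index (r k) ` K) / (A * r k powr (- 2 * \<epsilon>)) *
      energy (band (r k) (L * r k)) (cube_index (r k) ` K) (grid_proj i j (r k) a)" for k
  proof (rule dense_cubes_le_energy[OF K C rd _ _ a])
    have LS: "L * r k = r (Suc k)" by (simp add: r_def)
    show "L * r k \<in> dyadic" unfolding LS by (rule rd)
    show "5 * r k \<le> L * r k" using L r[of k] by simp
    show "0 < A * r k powr (- 2 * \<epsilon>)" using A r[of k] by simp
    show "V k \<subseteq> K" using H(1) by (auto simp: V_def)
    show "A * r k powr (- 2 * \<epsilon>) \<le> tube_density i j a K (r k) z" if "z \<in> V k" for z
      using that by (simp add: V_def)
    show "10 * C * tube_density i j a K (L * r k) z \<le> tube_density i j a K (r k) z" if "z \<in> V k" for z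
    proof -
      have "10 * C * tube_density i j a K (L * r k) z \<le> 10 * C * (A * (L * r k) powr (- 2 * \<epsilon>))"
        using that C(2) unfolding LS by (intro mult_left_mono) (auto simp: V_def)
      also have "\<dots> = (10 * C / L powr (2 * \<epsilon>)) * (A * r k powr (- 2 * \<epsilon>))"
        using L r[of k] by (simp add: powr_mult powr_minus_divide)
      also have "\<dots> \<le> 1 * (A * r k powr (- 2 * \<epsilon>))"
        using L A by (intro mult_right_mono) auto
      also have "\<dots> \<le> tube_density i j a K (r k) z" using that by (simp add: V_def)
      finally show ?thesis .
    qed
  qed
  define \<J> where "\<J> = Sigma (scales L n) (\<lambda>k. cube_index (r k) ` V k)"
  have finV: "finite (cube_index (r k) ` V k)" for k
  proof -
    have "V k \<subseteq> K" using H(1) by (auto simp: V_def)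
    then show ?thesis using finite_cube_index[OF bounded_subset[OF K] r] by blast
  qed
  define D where "D J = {x \<in> V (fst J). cube_index (r (fst J)) x = snd J}" for J
  define d where "d J = 2 * r (fst J)" for J :: "nat \<times> (2 \<Rightarrow> int)"
  show ?thesis
  proof (rule that[of \<J> D d])
    show "finite \<J>" unfolding \<J>_def by (intro finite_SigmaI finV) simp
    show "H \<subseteq> (\<Union>J\<in>\<J>. D J)"
    proof
      fix z assume "z \<in> H"
      then obtain k where "k \<in> scales L n" "z \<in> V k" using HV by blast
      then show "z \<in> (\<Union>J\<in>\<J>. D J)"
        by (intro UN_I[of "(k, cube_index (r k) z)"]) (auto simp: \<J>_def D_def)
    qed
    show "bounded (D J) \<and> diameter (D J) \<le> d J" if "J \<in> \<J>" for J
      unfolding D_def d_def using cube_diameter[OF r, of "V (fst J)" "fst J" "snd J"] by simp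
    have "(\<Sum>J\<in>\<J>. d J powr w) = (\<Sum>k\<in>scales L n. \<Sum>q\<in>cube_index (r k) ` V k. (2 * r k) powr w)"
      unfolding \<J>_def d_def by (subst sum.Sigma) (auto simp: finV split_def)
    also have "\<dots> = (\<Sum>k\<in>scales L n. 2 powr w * (r k powr w * card (cube_index (r k) ` V k)))"
      using r by (intro sum.cong refl) (simp add: powr_mult less_imp_le)
    also have "\<dots> \<le> (\<Sum>k\<in>scales L n. 2 powr w * (r k powr w * (200 * card (cube_index (r k) ` K) / (A * r k powr (- 2 * \<epsilon>)) *
      energy (band (r k) (L * r k)) (cube_index (r k) ` K) (grid_proj i j (r k) a))))"
      by (intro sum_mono mult_left_mono count) auto
    also have "\<dots> = 2 powr w * cover_cost i j K L \<epsilon> \<beta> w n a"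
      by (simp add: cover_cost_def Let_def sum_distrib_left r_def A_def \<delta>_def)
    finally show "(\<Sum>J\<in>\<J>. d J powr w) \<le> 2 powr w * cover_cost i j K L \<epsilon> \<beta> w n a" .
  qed
qed

text \<open>Borel--Cantelli in the form of monotone convergence.\<close>

lemma AE_tendsto_zero_if_integrals_summable:
  fixes f :: "nat \<Rightarrow> 'a \<Rightarrow> real"
  assumes int: "\<And>n. integrable M (f n)" and nn: "\<And>n x. 0 \<le> f n x"
    and le: "\<And>n. (\<integral>x. f n x \<partial>M) \<le> c n" and c: "summable c"
  shows "AE x in M. (\<lambda>n. f n x) \<longlonglongrightarrow> 0"
proof -
  have [measurable]: "f n \<in> borel_measurable M" for n using int by blast
  have c0: "0 \<le> c n" for n
    using le[of n] Bochner_Integration.integral_nonneg[of M "f n"] nn by (meson order_trans)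
  have "(\<integral>\<^sup>+x. (\<Sum>n. ennreal (f n x)) \<partial>M) = (\<Sum>n. \<integral>\<^sup>+x. ennreal (f n x) \<partial>M)"
    by (rule nn_integral_suminf) simp
  also have "\<dots> = (\<Sum>n. ennreal (\<integral>x. f n x \<partial>M))"
    using int nn by (simp add: nn_integral_eq_integral)
  also have "\<dots> \<le> (\<Sum>n. ennreal (c n))"
    using le by (intro suminf_le ennreal_leI) auto
  also have "\<dots> = ennreal (suminf c)" using c c0 by (simp add: suminf_ennreal2)
  also have "\<dots> < \<infinity>" by simp
  finally have "AE x in M. (\<Sum>n. ennreal (f n x)) \<noteq> \<infinity>"
    by (intro nn_integral_PInf_AE) auto
  then show ?thesis
  proof eventually_elim
    case (elim x)
    then have "summable (\<lambda>n. f n x)" using nn by (intro summable_suminf_not_top) auto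
    then show ?case by (rule summable_LIMSEQ_zero)
  qed
qed

text \<open>The number of cubes of \<open>K\<close> at scale \<open>r\<close> cancels between the Chebyshev bound and the average energy. With
\<open>\<delta> = (1/2) ^ n\<close>, each scale costs on average at most a constant times
\<open>r powr (w - 1 + \<epsilon>) * \<delta> powr \<beta>\<close>, which for \<open>\<delta> \<le> r \<le> 1\<close> and the assumed exponents is at most
\<open>\<delta> powr (2 * \<epsilon>)\<close>; there are at most \<open>n + 1\<close> scales.\<close>

lemma AE_cover_cost_tendsto_zero:
  fixes K :: "(real^2) set" and i j :: 2
  assumes K: "bounded K" "K \<noteq> {}" and ij: "i \<noteq> j" and L: "L \<ge> 5" and \<epsilon>: "\<epsilon> > 0"
    and \<beta>: "2 * \<epsilon> \<le> \<beta>" and w: "1 + \<epsilon> - \<beta> \<le> w"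
  shows "AE a in lborel. \<bar>a\<bar> \<le> 1 \<longrightarrow> (\<lambda>n. cover_cost i j K L \<epsilon> \<beta> w n a) \<longlonglongrightarrow> 0"
proof -
  obtain C where C: "C > 0" "\<And>r. 0 < r \<Longrightarrow> r \<le> 1 \<Longrightarrow>
     (\<integral>a. tent a * energy (band r (L * r)) (cube_index r ` K) (grid_proj i j r a) \<partial>lborel)
        \<le> C * r powr (- 1 - \<epsilon>) / card (cube_index r ` K)"
    using average_energy_bound[OF K ij L \<epsilon>] by blast
  define f where "f n a = tent a * cover_cost i j K L \<epsilon> \<beta> w n a" for n a
  define q :: real where "q = (1/2) powr (2 * \<epsilon>)"
  have q: "0 < q" "q < 1" using \<epsilon> half_powr_less[of "2 * \<epsilon>"] by (auto simp: q_def)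
  define r where "r n k = (1/2) ^ n * L ^ k" for n k
  have r: "r n k > 0" for n k using L by (simp add: r_def)
  define co where "co n k = r n k powr w * (200 * card (cube_index (r n k) ` K) / (((1/2) ^ n) powr (- \<beta>) * r n k powr (- 2 * \<epsilon>)))" for n k
  define g where "g n k a = tent a * energy (band (r n k) (L * r n k)) (cube_index (r n k) ` K) (grid_proj i j (r n k) a)" for n k a
  have f: "f n = (\<lambda>a. \<Sum>k\<in>scales L n. co n k * g n k a)" for n
    by (simp add: f_def cover_cost_def Let_def co_def g_def r_def sum_distrib_left mult_ac fun_eq_iff)
  have intg: "integrable lborel (g n k)" for n k
  proof -
    interpret kernel "band (r n k) (L * r n k)" "1 / r n k" "L * r n k" 2
      using r[of n k] L by (intro kernel_band) auto
    show ?thesis unfolding g_def by (rule integrable_tent_energy)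
  qed
  have summand: "co n k * (\<integral>a. g n k a \<partial>lborel) \<le> 200 * C * q ^ n" if k: "k \<in> scales L n" for n k
  proof -
    define \<delta> :: real where "\<delta> = (1/2) ^ n"
    define N where "N = real (card (cube_index (r n k) ` K))"
    have \<delta>: "\<delta> > 0" "\<delta> \<le> r n k" "r n k < 1"
      using k L one_le_power[of L k] by (auto simp: \<delta>_def r_def scales_def)
    have N: "N > 0" using finite_cube_index[OF K(1) r] K(2) by (simp add: N_def card_gt_0_iff)
    have "co n k \<ge> 0" by (simp add: co_def)
    then have "co n k * (\<integral>a. g n k a \<partial>lborel) \<le> co n k * (C * r n k powr (- 1 - \<epsilon>) / N)"
      unfolding g_def N_def using C(2)[OF r, of n k] \<delta> by (intro mult_left_mono) auto
    also have "\<dots> = 200 * C * (r n k powr w * \<delta> powr \<beta> * r n k powr (2 * \<epsilon>) * r n k powr (- 1 - \<epsilon>))"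
      using N \<delta>(1) r[of n k] by (simp add: co_def N_def \<delta>_def powr_minus_divide)
    also have "r n k powr w * \<delta> powr \<beta> * r n k powr (2 * \<epsilon>) * r n k powr (- 1 - \<epsilon>)
        = (r n k powr w * r n k powr (2 * \<epsilon>) * r n k powr (- 1 - \<epsilon>)) * \<delta> powr \<beta>"
      by (simp only: mult_ac)
    also have "r n k powr w * r n k powr (2 * \<epsilon>) * r n k powr (- 1 - \<epsilon>) = r n k powr (w - 1 + \<epsilon>)"
      by (simp add: algebra_simps flip: powr_add)
    also have "\<delta> powr \<beta> = \<delta> powr (\<beta> - 2 * \<epsilon>) * \<delta> powr (2 * \<epsilon>)"
      by (simp flip: powr_add)
    also have "r n k powr (w - 1 + \<epsilon>) * (\<delta> powr (\<beta> - 2 * \<epsilon>) * \<delta> powr (2 * \<epsilon>))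
        = r n k powr (w - 1 + \<epsilon>) * \<delta> powr (\<beta> - 2 * \<epsilon>) * \<delta> powr (2 * \<epsilon>)"
      by (simp only: mult_ac)
    also have "\<dots> \<le> r n k powr (w - 1 + \<epsilon>) * r n k powr (\<beta> - 2 * \<epsilon>) * \<delta> powr (2 * \<epsilon>)"
      using \<delta> \<beta> by (intro mult_right_mono mult_left_mono powr_mono2) auto
    also have "\<dots> = r n k powr (w - 1 + \<beta> - \<epsilon>) * \<delta> powr (2 * \<epsilon>)" by (simp add: algebra_simps flip: powr_add)
    also have "\<dots> \<le> 1 * \<delta> powr (2 * \<epsilon>)"
      using \<delta> r[of n k] w by (intro mult_right_mono powr_le1) auto
    also have "\<dots> = q ^ n" by (simp add: q_def \<delta>_def powr_power powr_powr mult.commute flip: powr_realpow)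
    finally show ?thesis using C(1) by simp
  qed
  have "AE a in lborel. (\<lambda>n. f n a) \<longlonglongrightarrow> 0"
  proof (rule AE_tendsto_zero_if_integrals_summable)
    show "integrable lborel (f n)" for n unfolding f using intg by auto
    show "0 \<le> f n a" for n a unfolding f_def using L by (intro mult_nonneg_nonneg tent_nonneg cover_cost_nonneg)
    show "(\<integral>a. f n a \<partial>lborel) \<le> 200 * C * (real (Suc n) * q ^ n)" for n
    proof -
      have "(\<integral>a. f n a \<partial>lborel) = (\<Sum>k\<in>scales L n. co n k * (\<integral>a. g n k a \<partial>lborel))"
        unfolding f using intg by (subst Bochner_Integration.integral_sum) auto
      also have "\<dots> \<le> (\<Sum>k\<in>scales L n. 200 * C * q ^ n)" by (intro sum_mono summand)
      also have "\<dots> = card (scales L n) * (200 * C * q ^ n)" by simp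
      also have "\<dots> \<le> Suc n * (200 * C * q ^ n)"
      proof (intro mult_right_mono)
        have "card (scales L n) \<le> card {..n}" by (intro card_mono) (auto simp: scales_def)
        then show "real (card (scales L n)) \<le> real (Suc n)" by simp
      qed (use C(1) q in auto)
      finally show ?thesis by (simp add: mult_ac)
    qed
    show "summable (\<lambda>n. 200 * C * (real (Suc n) * q ^ n))"
      using geometric_deriv_sums[of q] q by (intro summable_mult) (auto simp: sums_iff)
  qed
  then show ?thesis
  proof eventually_elim
    case (elim a)
    show ?case
    proof
      assume a: "\<bar>a\<bar> \<le> 1"
      show "(\<lambda>n. cover_cost i j K L \<epsilon> \<beta> w n a) \<longlonglongrightarrow> 0"
      proof (rule tendsto_sandwich[OF _ _ tendsto_const elim])
        show "\<forall>\<^sub>F n in sequentially. 0 \<le> cover_cost i j K L \<epsilon> \<beta> w n a"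
          using cover_cost_nonneg[OF L] by simp
        show "\<forall>\<^sub>F n in sequentially. cover_cost i j K L \<epsilon> \<beta> w n a \<le> f n a"
          unfolding f_def using mult_right_mono[OF tent_ge_1[OF a] cover_cost_nonneg[OF L]] by simp
      qed
    qed
  qed
qed

text \<open>Slices of dimension at least \<open>s\<close> have at least \<open>\<delta> powr (- (s - \<epsilon>))\<close> cubes at every small scale \<open>\<delta>\<close>, while
\<open>K\<close> has at most \<open>\<delta> powr (- (t + \<epsilon>))\<close> cubes for infinitely many of the scales \<open>\<delta> = (1/2) ^ n\<close>. At such a
scale the tubes around these slices are dense, and the covers constructed above apply.\<close>

lemma AE_heavy_slices_null:
  fixes K :: "(real^2) set" and i j :: 2
  assumes K: "compact K" "sub_uniformly_distributed K" and dim: "hausdorff_dim K = ereal t"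
    and t: "0 < t" and s: "max (t - 1) 0 < s" and w: "max (t - s) 0 < w" and ij: "i \<noteq> j"
  shows "AE a in lborel. \<bar>a\<bar> \<le> 1 \<longrightarrow>
    hausdorff_measure w {z\<in>K. hausdorff_dim (K \<inter> {y. shear i j a y = shear i j a z}) \<ge> ereal s} = 0"
proof -
  have K': "bounded K" "K \<noteq> {}"
    using compact_imp_bounded[OF K(1)] dim t hausdorff_dim_empty[where 'a = "real^2"] by (auto simp: zero_ereal_def)
  obtain C where C: "C > 0" "sub_uniform_const C K" using sub_uniformly_distributed_const[OF K(2)] .
  \<comment> \<open>Slices keep a positive exponent \<open>s - \<epsilon>\<close>, the density exponent \<open>\<beta>\<close> stays positive,
    \<open>w\<close> absorbs all losses, and \<open>2 * \<epsilon> \<le> 1\<close> keeps critical scales below \<open>1\<close>.\<close>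
  define \<epsilon> where "\<epsilon> = Min {s / 2, (1 + s - t) / 6, (w - max (t - s) 0) / 5, 1 / 2}"
  have \<epsilon>: "\<epsilon> > 0" "\<epsilon> \<le> s / 2" "6 * \<epsilon> \<le> 1 + s - t" "max (t - s) 0 + 5 * \<epsilon> \<le> w" "2 * \<epsilon> \<le> 1"
  proof -
    have "\<epsilon> \<in> {s / 2, (1 + s - t) / 6, (w - max (t - s) 0) / 5, 1 / 2}"
      unfolding \<epsilon>_def by (rule Min_in) auto
    moreover have "s / 2 > 0" "(1 + s - t) / 6 > 0" "(w - max (t - s) 0) / 5 > 0" using s w by auto
    ultimately show "\<epsilon> > 0" by auto
    have "\<epsilon> \<le> s / 2" "\<epsilon> \<le> (1 + s - t) / 6" "\<epsilon> \<le> (w - max (t - s) 0) / 5" "\<epsilon> \<le> 1 / 2"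
      unfolding \<epsilon>_def by (intro Min_le; simp)+
    then show "\<epsilon> \<le> s / 2" and "6 * \<epsilon> \<le> 1 + s - t" and "max (t - s) 0 + 5 * \<epsilon> \<le> w" and "2 * \<epsilon> \<le> 1"
      by (simp_all add: le_divide_eq)
  qed
  define \<beta> where "\<beta> = 1 + s - t - 4 * \<epsilon>"
  have \<beta>: "2 * \<epsilon> \<le> \<beta>" "\<beta> > 0" "1 + \<epsilon> - \<beta> \<le> w" 
  proof -
    have "t - s \<le> max (t - s) 0" by simp
    then show "1 + \<epsilon> - \<beta> \<le> w" using \<epsilon> unfolding \<beta>_def by linarith
    show "2 * \<epsilon> \<le> \<beta>" "\<beta> > 0" using \<epsilon> by (auto simp: \<beta>_def)
  qed
  \<comment> \<open>The drop of the density by \<open>L powr (-2 * \<epsilon>)\<close> must beat the constant \<open>10 * C\<close>.\<close>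
  have "\<exists>l. max 5 ((10 * C) powr (1 / (2 * \<epsilon>))) < (2::real) ^ l" by (rule real_arch_pow) simp
  then obtain l where l: "max 5 ((10 * C) powr (1 / (2 * \<epsilon>))) < (2::real) ^ l" ..
  define L :: real where "L = 2 ^ l"
  have L: "L \<ge> 5" "10 * C \<le> L powr (2 * \<epsilon>)"
  proof -
    show "L \<ge> 5" using l by (simp add: L_def)
    have "((10 * C) powr (1 / (2 * \<epsilon>))) powr (2 * \<epsilon>) \<le> L powr (2 * \<epsilon>)"
      using l \<epsilon>(1) by (intro powr_mono2) (auto simp: L_def)
    then show "10 * C \<le> L powr (2 * \<epsilon>)" using C(1) \<epsilon>(1) by (simp add: powr_powr)
  qed
  have few: "\<exists>\<^sub>F n in sequentially. card (cube_index ((1/2) ^ n) ` K) \<le> ((1/2) ^ n) powr (- (t + \<epsilon>))"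
    using t \<epsilon>(1) dim
    by (intro few_cubes_if_hausdorff_measure_zero[OF K(1) K'(2) C] hausdorff_measure_zero_if_dim_less) auto
  have "AE a in lborel. \<bar>a\<bar> \<le> 1 \<longrightarrow> (\<lambda>n. cover_cost i j K L \<epsilon> \<beta> w n a) \<longlonglongrightarrow> 0"
    by (rule AE_cover_cost_tendsto_zero[OF K' ij L(1) \<epsilon>(1) \<beta>(1,3)])
  then show ?thesis
  proof eventually_elim
    case (elim a)
    show ?case
    proof
      assume a: "\<bar>a\<bar> \<le> 1"
      then have cost: "(\<lambda>n. cover_cost i j K L \<epsilon> \<beta> w n a) \<longlonglongrightarrow> 0" using elim by blast
      define fib where "fib z = K \<inter> {y. shear i j a y = shear i j a z}" for z
      \<comment> \<open>Slices of dimension at least \<open>s\<close> have many cubes at all small scales, but how small depends on the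
        point; on \<open>H m\<close> it is uniform.\<close>
      define H where "H m = {z\<in>K. \<forall>n\<ge>m. ((1/2) ^ n) powr (- (s - \<epsilon>)) < card (cube_index ((1/2) ^ n) ` fib z)}" for m
      have sub: "{z\<in>K. hausdorff_dim (fib z) \<ge> ereal s} \<subseteq> (\<Union>m. H m)"
      proof clarify
        fix z assume z: "z \<in> K" "ereal s \<le> hausdorff_dim (fib z)"
        have "hausdorff_measure (s - \<epsilon> / 2) (fib z) \<noteq> 0"
        proof
          assume "hausdorff_measure (s - \<epsilon> / 2) (fib z) = 0"
          then have "hausdorff_dim (fib z) \<le> ereal (s - \<epsilon> / 2)" using \<epsilon> s by (intro hausdorff_dim_le) auto
          then have "ereal s \<le> ereal (s - \<epsilon> / 2)" using z(2) by (rule order_trans[rotated])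
          then show False using \<epsilon>(1) by simp
        qed
        moreover have "bounded (fib z)" using bounded_subset[OF K'(1)] by (auto simp: fib_def)
        ultimately have "\<not> (\<exists>\<^sub>F n in sequentially. card (cube_index ((1/2) ^ n) ` fib z) \<le> ((1/2) ^ n) powr (- (s - \<epsilon>)))"
          using hausdorff_measure_zero_if_few_cubes[of "fib z" "s - \<epsilon> / 2" "s - \<epsilon>"] \<epsilon> s by auto
        then show "z \<in> (\<Union>m. H m)" using z(1)
          by (auto simp: not_frequently not_le eventually_sequentially H_def)
      qed
      \<comment> \<open>At a scale where \<open>K\<close> has few cubes, the cubes of the slice form a tube of high density.\<close>
      have dens: "((1/2) ^ n) powr (- \<beta> - 2 * \<epsilon>) \<le> tube_density i j a K ((1/2) ^ n) z"
        if n: "card (cube_index ((1/2) ^ n) ` K) \<le> ((1/2) ^ n) powr (- (t + \<epsilon>))" "m \<le> n" and z: "z \<in> H m" for n m z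
      proof -
        define \<delta> :: real where "\<delta> = (1/2) ^ n"
        define N where "N = real (card (cube_index \<delta> ` K))"
        have \<delta>: "\<delta> > 0" by (simp add: \<delta>_def)
        have fin: "finite (cube_index \<delta> ` K)" using finite_cube_index K'(1) \<delta> by blast
        have N: "0 < N" "N \<le> \<delta> powr (- (t + \<epsilon>))" using n fin K'(2) by (auto simp: N_def \<delta>_def card_gt_0_iff)
        define T where "T = {k \<in> cube_index \<delta> ` K. \<bar>grid_proj i j \<delta> a k - shear i j a z\<bar> \<le> 4 * \<delta>}"
        have "cube_index \<delta> ` fib z \<subseteq> T"
        proof clarify
          fix y assume y: "y \<in> fib z"
          then show "cube_index \<delta> y \<in> T"
            using grid_proj_close[OF \<delta> a, of i j y] \<delta> by (auto simp: T_def fib_def)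
        qed
        then have "card (cube_index \<delta> ` fib z) \<le> card T" using fin by (intro card_mono) (auto simp: T_def)
        moreover have "\<delta> powr (- (s - \<epsilon>)) < card (cube_index \<delta> ` fib z)" using z n(2) by (auto simp: H_def \<delta>_def)
        ultimately have T: "\<delta> powr (- (s - \<epsilon>)) \<le> card T" by linarith
        have "\<delta> powr (- \<beta> - 2 * \<epsilon>) = \<delta> powr (- (s - \<epsilon>) - (- (t + \<epsilon>) + 1))"
          by (rule arg_cong[where f = "\<lambda>x. \<delta> powr x"]) (simp add: \<beta>_def)
        also have "\<dots> = \<delta> powr (- (s - \<epsilon>)) / (\<delta> powr (- (t + \<epsilon>)) * \<delta> powr 1)"
          by (simp only: powr_diff powr_add)
        also have "\<dots> = \<delta> powr (- (s - \<epsilon>)) / (\<delta> powr (- (t + \<epsilon>)) * \<delta>)" using \<delta> by simp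
        also have "\<dots> \<le> card T / (N * \<delta>)"
          using N \<delta> T by (intro frac_le mult_mono) auto
        finally show ?thesis by (simp add: tube_density_def T_def N_def \<delta>_def)
      qed
      have "hausdorff_measure w (H m) = 0" for m
      proof (rule hausdorff_measure_zero_countable_family)
        show w0: "w > 0" using w by simp
        fix \<eta> :: real assume "\<eta> > 0"
        then have "\<forall>\<^sub>F n in sequentially. cover_cost i j K L \<epsilon> \<beta> w n a < \<eta> / 2 powr w"
          using order_tendstoD(2)[OF cost, of "\<eta> / 2 powr w"] by simp
        moreover have "\<forall>\<^sub>F n in sequentially. n > m" by (rule eventually_gt_at_top)
        ultimately have "\<forall>\<^sub>F n in sequentially. cover_cost i j K L \<epsilon> \<beta> w n a < \<eta> / 2 powr w \<and> n > m"
          by (rule eventually_conj)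
        from frequently_eventually_conj[OF few this] obtain n where n: "n > m"
          "card (cube_index ((1/2) ^ n) ` K) \<le> ((1/2) ^ n) powr (- (t + \<epsilon>))"
          "cover_cost i j K L \<epsilon> \<beta> w n a < \<eta> / 2 powr w" by (auto dest!: frequently_ex)
        have n0: "n > 0" using n(1) by simp
        obtain \<J> :: "(nat \<times> (2 \<Rightarrow> int)) set" and D d where J: "finite \<J>" "H m \<subseteq> (\<Union>J\<in>\<J>. D J)"
          "\<And>J. J \<in> \<J> \<Longrightarrow> bounded (D J) \<and> diameter (D J) \<le> d J"
          "(\<Sum>J\<in>\<J>. d J powr w) \<le> 2 powr w * cover_cost i j K L \<epsilon> \<beta> w n a"
        proof (rule dense_points_cover[OF K'(1) C(2,1) L_def L \<epsilon>(1,5) \<beta>(2) n0 a, of "H m" i j w])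
          show "H m \<subseteq> K" by (auto simp: H_def)
          show "((1/2) ^ n) powr (- \<beta> - 2 * \<epsilon>) \<le> tube_density i j a K ((1/2) ^ n) z" if "z \<in> H m" for z
            using dens[OF n(2) _ that] n(1) by simp
        qed blast
        have "2 powr w * cover_cost i j K L \<epsilon> \<beta> w n a \<le> \<eta>" using n(3) by (simp add: pos_less_divide_eq mult.commute)
        then have tot: "(\<Sum>J\<in>\<J>. d J powr w) \<le> \<eta>" using J(4) by linarith
        show "\<exists>(\<J> :: (nat \<times> (2 \<Rightarrow> int)) set) D d. countable \<J> \<and> H m \<subseteq> (\<Union>J\<in>\<J>. D J) \<and>
        (\<forall>J\<in>\<J>. bounded (D J) \<and> diameter (D J) \<le> d J) \<and>
        (\<forall>\<F>. finite \<F> \<longrightarrow> \<F> \<subseteq> \<J> \<longrightarrow> (\<Sum>J\<in>\<F>. d J powr w) \<le> \<eta>)"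
        proof (intro exI conjI allI impI)
          show "countable \<J>" using J(1) by (rule countable_finite)
          show "H m \<subseteq> (\<Union>J\<in>\<J>. D J)" by fact
          show "\<forall>J\<in>\<J>. bounded (D J) \<and> diameter (D J) \<le> d J" using J(3) by blast
          fix \<F> assume "finite \<F>" "\<F> \<subseteq> \<J>"
          then have "(\<Sum>J\<in>\<F>. d J powr w) \<le> (\<Sum>J\<in>\<J>. d J powr w)" using J(1) by (intro sum_mono2) auto
          then show "(\<Sum>J\<in>\<F>. d J powr w) \<le> \<eta>" using tot by linarith
        qed
      qed
      then have "hausdorff_measure w (\<Union>m. H m) = 0" using w by (intro hausdorff_measure_zero_UN) auto
      then show "hausdorff_measure w {z\<in>K. hausdorff_dim (K \<inter> {y. shear i j a y = shear i j a z}) \<ge> ereal s} = 0"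
        using sub unfolding fib_def by (rule hausdorff_measure_zero_mono)
    qed
  qed
qed

section \<open>From slopes to the circle\<close>

text \<open>A Lebesgue null set is covered by non-overlapping intervals of small total length, and their images
have diameters at most \<open>B\<close> times as large.\<close>

lemma hausdorff_measure_lipschitz_image_null:
  fixes g :: "real \<Rightarrow> 'a::metric_space"
  assumes Z: "Z \<in> null_sets lebesgue" "Z \<subseteq> {-1..1}" and B: "B > 0"
    and lip: "\<And>x y. dist (g x) (g y) \<le> B * \<bar>x - y\<bar>"
  shows "hausdorff_measure 1 (g ` Z) = 0"
proof (rule hausdorff_measure_zero_countable_family)
  fix \<eta> :: real assume \<eta>: "\<eta> > 0"
  have ZL: "Z \<in> lmeasurable" "measure lebesgue Z = 0"
    using Z(1) negligible_imp_measurable negligible_imp_measure0 by (auto simp: negligible_iff_null_sets)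
  have pos: "\<eta> / B > 0" and box: "Z \<subseteq> cbox (-1) 1" using \<eta> B Z(2) by auto
  obtain \<D> where D: "countable \<D>" "\<And>K. K \<in> \<D> \<Longrightarrow> K \<subseteq> cbox (-1) 1 \<and> K \<noteq> {} \<and> (\<exists>c d::real. K = cbox c d)"
    "pairwise (\<lambda>A B. interior A \<inter> interior B = {}) \<D>"
    "Z \<subseteq> \<Union>\<D>" "\<Union>\<D> \<in> lmeasurable" "measure lebesgue (\<Union>\<D>) \<le> measure lebesgue Z + \<eta> / B"
    by (rule measurable_outer_intervals_bounded[OF ZL(1) box pos]) (rule that)
  define d where "d J = B * measure lebesgue J" for J :: "real set"
  show "\<exists>(\<J> :: real set set) D d. countable \<J> \<and> g ` Z \<subseteq> (\<Union>J\<in>\<J>. D J) \<and>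
        (\<forall>J\<in>\<J>. bounded (D J) \<and> diameter (D J) \<le> d J) \<and>
        (\<forall>\<F>. finite \<F> \<longrightarrow> \<F> \<subseteq> \<J> \<longrightarrow> (\<Sum>J\<in>\<F>. d J powr 1) \<le> \<eta>)"
  proof (intro exI conjI ballI allI impI)
    show "countable \<D>" by fact
    show "g ` Z \<subseteq> (\<Union>J\<in>\<D>. g ` J)" using D(4) by blast
    fix J assume "J \<in> \<D>"
    then obtain u v where J: "J = cbox u v" "u \<le> v" using D(2)[of J] by auto
    have *: "dist x y \<le> d J" if xy: "x \<in> g ` J" "y \<in> g ` J" for x y
    proof -
      from xy obtain x' y' where "x' \<in> J" "y' \<in> J" "x = g x'" "y = g y'" by blast
      then have "dist x y \<le> B * \<bar>x' - y'\<bar>" "\<bar>x' - y'\<bar> \<le> v - u" using lip J by auto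
      then have "dist x y \<le> B * (v - u)" using B by (meson mult_left_mono order_trans less_imp_le)
      then show ?thesis using J by (simp add: d_def)
    qed
    have "d J \<ge> 0" using B by (simp add: d_def)
    show "bounded (g ` J)"
      using * J unfolding bounded_def by (intro exI[of _ "g u"] exI[of _ "d J"]) auto
    show "diameter (g ` J) \<le> d J"
      unfolding diameter_def using * J \<open>d J \<ge> 0\<close> by (auto intro!: cSUP_least)
  next
    fix \<F> assume F: "finite \<F>" "\<F> \<subseteq> \<D>"
    have meas: "J \<in> lmeasurable" if "J \<in> \<F>" for J using D(2)[of J] that F by auto
    have "(\<Sum>J\<in>\<F>. d J powr 1) = (\<Sum>J\<in>\<F>. d J)" using B by (simp add: d_def)
    also have "\<dots> = B * (\<Sum>J\<in>\<F>. measure lebesgue J)" by (simp add: d_def sum_distrib_left)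
    also have "(\<Sum>J\<in>\<F>. measure lebesgue J) = measure lebesgue (\<Union>\<F>)"
    proof (rule measure_negligible_finite_Union[symmetric])
      show "pairwise (\<lambda>S T. negligible (S \<inter> T)) \<F>"
      proof (rule pairwiseI)
        fix S T assume ST: "S \<in> \<F>" "T \<in> \<F>" "S \<noteq> T"
        then have "S \<in> \<D>" "T \<in> \<D>" using F by auto
        then have disj: "interior S \<inter> interior T = {}" using D(3) ST(3) by (auto simp: pairwise_def)
        obtain a b c e where "S = cbox a b" "T = cbox c e" using \<open>S \<in> \<D>\<close> \<open>T \<in> \<D>\<close> by (metis D(2))
        then have "S \<inter> T = cbox (max a c) (min b e)" by auto
        moreover have "box (max a c) (min b e) = {}" using disj \<open>S = cbox a b\<close> \<open>T = cbox c e\<close>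
          by auto
        ultimately show "negligible (S \<inter> T)" by (simp only: negligible_interval)
      qed
    qed (use F meas in auto)
    also have "\<dots> \<le> measure lebesgue (\<Union>\<D>)"
      using F meas D(5) by (intro measure_mono_fmeasurable) auto
    also have "\<dots> \<le> \<eta> / B" using D(6) ZL(2) by simp
    finally show "(\<Sum>J\<in>\<F>. d J powr 1) \<le> \<eta>" using B by simp
  qed
qed simp

lemma dist_sgn_le:
  fixes v w :: "'a::real_normed_vector"
  assumes "norm v \<ge> 1" "norm w \<ge> 1"
  shows "dist (sgn v) (sgn w) \<le> 2 * dist v w"
proof -
  have nz: "norm v > 0" "norm w > 0" using assms by linarith+
  have "sgn v - sgn w = inverse (norm v) *\<^sub>R (v - w) + (inverse (norm v) - inverse (norm w)) *\<^sub>R w"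
    by (simp add: sgn_div_norm scaleR_diff_left scaleR_diff_right)
  then have "norm (sgn v - sgn w) \<le> norm (inverse (norm v) *\<^sub>R (v - w)) + norm ((inverse (norm v) - inverse (norm w)) *\<^sub>R w)"
    by (metis norm_triangle_ineq)
  also have "\<dots> = inverse (norm v) * norm (v - w) + \<bar>inverse (norm v) - inverse (norm w)\<bar> * norm w"
    using nz by simp
  also have "\<bar>inverse (norm v) - inverse (norm w)\<bar> * norm w = inverse (norm v) * \<bar>norm w - norm v\<bar>"
    using nz by (simp add: inverse_diff_inverse abs_mult)
  also have "\<dots> \<le> inverse (norm v) * norm (v - w)"
    using norm_triangle_ineq3[of w v] by (intro mult_left_mono) (auto simp: norm_minus_commute)
  also have "inverse (norm v) * norm (v - w) + inverse (norm v) * norm (v - w) \<le> 1 * norm (v - w) + 1 * norm (v - w)"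
    using assms nz by (intro add_mono mult_right_mono) (auto simp: field_simps)
  finally show ?thesis by (simp add: dist_norm)
qed

text \<open>This vector spans the common direction of the fibres of \<open>shear i j a\<close>.\<close>

definition slope_vector :: "2 \<Rightarrow> 2 \<Rightarrow> real \<Rightarrow> real^2" where
  "slope_vector i j a = axis j 1 - a *\<^sub>R axis i 1"

text \<open>The two arcs of the circle on which \<open>\<bar>e $ i\<bar> \<le> \<bar>e $ j\<bar>\<close> are Lipschitz images of the interval of
slopes \<open>\<bar>a\<bar> \<le> 1\<close>, and Lipschitz maps preserve null sets.\<close>

lemma circle_slope_null:
  fixes i j :: 2 and P :: "real \<Rightarrow> bool"
  assumes ij: "i \<noteq> j" and ae: "AE a in lborel. \<bar>a\<bar> \<le> 1 \<longrightarrow> P a"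
  shows "hausdorff_measure 1 {e \<in> sphere (0 :: real^2) 1. \<bar>e $ i\<bar> \<le> \<bar>e $ j\<bar> \<and> \<not> P (- (e $ i / e $ j))} = 0"
proof -
  define Z where "Z = {a. \<bar>a\<bar> \<le> 1 \<and> \<not> P a}"
  from ae obtain N where "N \<in> null_sets lborel" "{a \<in> space lborel. \<not> (\<bar>a\<bar> \<le> 1 \<longrightarrow> P a)} \<subseteq> N"
    by (auto elim!: AE_E simp: null_sets_def)
  then have Z: "Z \<in> null_sets lebesgue" 
    using null_sets_completion_subset[of Z N lborel] null_sets_completionI[of N lborel] by (auto simp: Z_def)
  have Z1: "Z \<subseteq> {-1..1}" by (auto simp: Z_def abs_le_iff)
  define g where "g c a = c *\<^sub>R sgn (slope_vector i j a)" for c a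
  have lip: "dist (g c x) (g c y) \<le> 2 * \<bar>x - y\<bar>" if "\<bar>c\<bar> = 1" for c x y
  proof -
    have n1: "norm (slope_vector i j a) \<ge> 1" for a
      using component_le_norm_cart[of "slope_vector i j a" j] ij by (simp add: slope_vector_def axis_def)
    have "dist (g c x) (g c y) = dist (sgn (slope_vector i j x)) (sgn (slope_vector i j y))"
      using that by (simp add: g_def dist_norm flip: scaleR_diff_right)
    also have "\<dots> \<le> 2 * dist (slope_vector i j x) (slope_vector i j y)" by (intro dist_sgn_le n1)
    also have "dist (slope_vector i j x) (slope_vector i j y) = norm ((y - x) *\<^sub>R (axis i 1 :: real^2))"
      by (simp add: slope_vector_def dist_norm scaleR_diff_left)
    also have "\<dots> = \<bar>x - y\<bar>" by (simp add: norm_axis_1 abs_minus_commute)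
    finally show ?thesis .
  qed
  have cases: "x = i \<or> x = j" for x :: 2 using ij exhaust_2[of x] exhaust_2[of i] exhaust_2[of j] by auto
  have "e \<in> g 1 ` Z \<union> g (- 1) ` Z"
    if e: "e \<in> sphere 0 1" "\<bar>e $ i\<bar> \<le> \<bar>e $ j\<bar>" "\<not> P (- (e $ i / e $ j))" for e
  proof -
    define a where "a = - (e $ i / e $ j)"
    have ej: "e $ j \<noteq> 0"
    proof
      assume "e $ j = 0"
      then have "e $ x = 0" for x using cases[of x] e(2) by auto
      then have "e = 0" by (simp add: vec_eq_iff)
      then show False using e(1) by simp
    qed
    have "\<bar>a\<bar> \<le> 1" using e(2) ej by (simp add: a_def abs_divide)
    then have aZ: "a \<in> Z" using e(3) by (simp add: Z_def a_def)
    have "e $ x = ((e $ j) *\<^sub>R slope_vector i j a) $ x" for x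
      using cases[of x] ij ej by (auto simp: slope_vector_def axis_def a_def)
    then have e_eq: "e = (e $ j) *\<^sub>R slope_vector i j a" by (intro vec_eq_iff[THEN iffD2] allI)
    have "e = sgn e" using e(1) by (simp add: sgn_div_norm)
    also have "\<dots> = sgn ((e $ j) *\<^sub>R slope_vector i j a)" by (rule arg_cong[OF e_eq])
    also have "\<dots> = g (sgn (e $ j)) a" by (simp add: sgn_scaleR g_def)
    finally have "e = g (sgn (e $ j)) a" .
    then show ?thesis using aZ ej by (cases "e $ j > 0") auto
  qed
  then have "{e \<in> sphere (0 :: real^2) 1. \<bar>e $ i\<bar> \<le> \<bar>e $ j\<bar> \<and> \<not> P (- (e $ i / e $ j))} \<subseteq> g 1 ` Z \<union> g (- 1) ` Z"
    by blast
  moreover have "hausdorff_measure 1 (g 1 ` Z \<union> g (- 1) ` Z) = 0"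
    by (intro hausdorff_measure_zero_Un hausdorff_measure_lipschitz_image_null[OF Z Z1, of 2] lip) auto
  ultimately show ?thesis by (rule hausdorff_measure_zero_mono[rotated])
qed

lemma line_through_subset_fibre:
  assumes "e $ j \<noteq> 0"
  shows "line_through e z \<subseteq> {y. shear i j (- (e $ i / e $ j)) y = shear i j (- (e $ i / e $ j)) z}"
  using assms by (auto simp: line_through_def span_singleton shear_def field_simps)

text \<open>The two coordinate charts together see every direction.\<close>

lemma heavy_part_at_null:
  fixes K :: "(real^2) set"
  assumes K: "compact K" "sub_uniformly_distributed K" and dim: "hausdorff_dim K = ereal t"
    and t: "0 < t" and s: "max (t - 1) 0 < s" and w: "max (t - s) 0 < w"
  shows "hausdorff_measure 1 {e \<in> sphere 0 1. hausdorff_measure w (heavy_part_at K e s) \<noteq> 0} = 0"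
proof -
  define H where "H i j a = {z\<in>K. hausdorff_dim (K \<inter> {y. shear i j a y = shear i j a z}) \<ge> ereal s}" for i j :: 2 and a
  define E where "E i j = {e \<in> sphere 0 1. \<bar>e $ i\<bar> \<le> \<bar>e $ j\<bar> \<and> hausdorff_measure w (H i j (- (e $ i / e $ j))) \<noteq> 0}" for i j :: 2
  have E: "hausdorff_measure 1 (E i j) = 0" if "i \<noteq> j" for i j
    unfolding E_def by (rule circle_slope_null[OF that AE_heavy_slices_null[OF K dim t s w that, folded H_def]])
  have "e \<in> E 1 2 \<union> E 2 1" if e: "e \<in> sphere 0 1" "hausdorff_measure w (heavy_part_at K e s) \<noteq> 0" for e
  proof -
    have key: "e \<in> E i j" if ij: "\<bar>e $ i\<bar> \<le> \<bar>e $ j\<bar>" "{i, j} = UNIV" for i j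
    proof -
      have "e $ j \<noteq> 0"
      proof
        assume "e $ j = 0"
        then have "e $ x = 0" for x using ij UNIV_I[of x] unfolding ij(2)[symmetric] by auto
        then have "e = 0" by (simp add: vec_eq_iff)
        then show False using e(1) by simp
      qed
      then have "heavy_part_at K e s \<subseteq> H i j (- (e $ i / e $ j))"
        unfolding heavy_part_at_def H_def
      proof (intro Collect_mono impI conjI; elim conjE)
        fix z assume z: "z \<in> K" "ereal s \<le> hausdorff_dim (K \<inter> line_through e z)"
        show "z \<in> K" by fact
        have "hausdorff_dim (K \<inter> line_through e z)
            \<le> hausdorff_dim (K \<inter> {y. shear i j (- (e $ i / e $ j)) y = shear i j (- (e $ i / e $ j)) z})"
          using line_through_subset_fibre[OF \<open>e $ j \<noteq> 0\<close>, of z i] by (intro hausdorff_dim_mono) blast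
        then show "ereal s \<le> hausdorff_dim (K \<inter> {y. shear i j (- (e $ i / e $ j)) y = shear i j (- (e $ i / e $ j)) z})"
          using z(2) by (rule order_trans[rotated])
      qed
      then have "hausdorff_measure w (H i j (- (e $ i / e $ j))) \<noteq> 0"
        using e(2) hausdorff_measure_zero_mono by blast
      then show ?thesis using e(1) ij(1) by (simp add: E_def)
    qed
    show ?thesis using key[of 1 2] key[of 2 1] by (cases "\<bar>e $ 1\<bar> \<le> \<bar>e $ 2\<bar>") (auto simp: UNIV_2)
  qed
  then have "{e \<in> sphere 0 1. hausdorff_measure w (heavy_part_at K e s) \<noteq> 0} \<subseteq> E 1 2 \<union> E 2 1" by blast
  moreover have "hausdorff_measure 1 (E 1 2 \<union> E 2 1) = 0"
    by (intro hausdorff_measure_zero_Un E) auto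
  ultimately show ?thesis by (rule hausdorff_measure_zero_mono[rotated])
qed

section \<open>Dimension of the heavy parts\<close>

lemma ess_sup_circle_le:
  assumes "\<And>w. w > b \<Longrightarrow> hausdorff_measure 1 {e \<in> sphere 0 1. \<not> f e \<le> ereal w} = 0"
  shows "ess_sup_circle f \<le> ereal b"
proof (rule ereal_le_epsilon2)
  fix \<epsilon> :: real assume "\<epsilon> > 0"
  then show "ess_sup_circle f \<le> ereal b + ereal \<epsilon>"
    using assms[of "b + \<epsilon>"] unfolding ess_sup_circle_def by (intro Inf_lower) simp
qed

theorem theorem1p15:
  fixes K :: "(real^2) set" and t :: real
  assumes "compact K"
    and "sub_uniformly_distributed K"
    and "hausdorff_dim K = ereal t"
    and "0 < t" and "t < 2"
  shows "(\<forall>s::real. max (t - 1) 0 < s \<and> s \<le> 1 \<longrightarrow> heavy_dim_at K s \<le> ereal (max (t - s) 0))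
    \<and> heavy_dim K \<le> 1"
proof (intro conjI allI impI)
  fix s :: real assume s: "max (t - 1) 0 < s \<and> s \<le> 1"
  show "heavy_dim_at K s \<le> ereal (max (t - s) 0)"
    unfolding heavy_dim_at_def
  proof (rule ess_sup_circle_le)
    fix w assume w: "max (t - s) 0 < w"
    have "{e \<in> sphere 0 1. \<not> hausdorff_dim (heavy_part_at K e s) \<le> ereal w}
        \<subseteq> {e \<in> sphere 0 1. hausdorff_measure w (heavy_part_at K e s) \<noteq> 0}"
    proof clarify
      fix e assume "\<not> hausdorff_dim (heavy_part_at K e s) \<le> ereal w"
        and "hausdorff_measure w (heavy_part_at K e s) = 0"
      then show False using hausdorff_dim_le[of w "heavy_part_at K e s"] w by simp
    qed
    moreover have "hausdorff_measure 1 {e \<in> sphere 0 1. hausdorff_measure w (heavy_part_at K e s) \<noteq> 0} = 0"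
      using s w by (intro heavy_part_at_null[OF assms(1-4)]) auto
    ultimately show "hausdorff_measure 1 {e \<in> sphere 0 1. \<not> hausdorff_dim (heavy_part_at K e s) \<le> ereal w} = 0"
      by (rule hausdorff_measure_zero_mono[rotated])
  qed
next
  define m where "m = max (t - 1) 0"
  have m: "0 \<le> m" "t - 1 \<le> m" by (auto simp: m_def)
  have threshold: "max (hausdorff_dim K - 1) 0 = ereal m"
    unfolding assms(3) m_def by (simp add: max_def one_ereal_def zero_ereal_def)
  \<comment> \<open>The strict inequality in the heavy part is exhausted by the thresholds \<open>S n\<close>, and \<open>t - S n < 1\<close> for each of them.\<close>
  define S where "S n = m + inverse (real (Suc n))" for n
  have "ess_sup_circle (\<lambda>e. hausdorff_dim (heavy_part K e)) \<le> ereal 1"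
  proof (rule ess_sup_circle_le)
    fix w :: real assume w: "1 < w"
    define E where "E n = {e \<in> sphere 0 1. hausdorff_measure w (heavy_part_at K e (S n)) \<noteq> 0}" for n
    have "hausdorff_measure 1 (E n) = 0" for n
      unfolding E_def
    proof (rule heavy_part_at_null[OF assms(1-4)])
      have pos: "inverse (real (Suc n)) > 0" by simp
      then show "max (t - 1) 0 < S n" by (simp add: S_def m_def)
      have "t - S n < 1" using m(2) pos unfolding S_def by linarith
      then show "max (t - S n) 0 < w" using w by simp
    qed
    then have "hausdorff_measure 1 (\<Union>n. E n) = 0" by (intro hausdorff_measure_zero_UN) auto
    moreover have "{e \<in> sphere 0 1. \<not> hausdorff_dim (heavy_part K e) \<le> ereal w} \<subseteq> (\<Union>n. E n)"
    proof
      fix e assume e: "e \<in> {e \<in> sphere 0 1. \<not> hausdorff_dim (heavy_part K e) \<le> ereal w}"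
      show "e \<in> (\<Union>n. E n)"
      proof (rule ccontr)
        assume "e \<notin> (\<Union>n. E n)"
        then have "hausdorff_measure w (\<Union>n. heavy_part_at K e (S n)) = 0"
          using e w by (intro hausdorff_measure_zero_UN) (auto simp: E_def)
        moreover have "heavy_part K e \<subseteq> (\<Union>n. heavy_part_at K e (S n))"
        proof
          fix z assume z: "z \<in> heavy_part K e"
          then have "ereal m < hausdorff_dim (K \<inter> line_through e z)"
            by (simp only: heavy_part_def mem_Collect_eq threshold)
          then obtain y where y: "m < y" "ereal y < hausdorff_dim (K \<inter> line_through e z)"
            using ereal_dense2[of "ereal m"] by (metis less_ereal.simps(1))
          then obtain n where "inverse (real (Suc n)) < y - m" using reals_Archimedean[of "y - m"] by auto
          then have "ereal (S n) \<le> ereal y" by (simp add: S_def)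
          then have "ereal (S n) \<le> hausdorff_dim (K \<inter> line_through e z)" using y(2) by order
          then show "z \<in> (\<Union>n. heavy_part_at K e (S n))" using z by (auto simp: heavy_part_at_def heavy_part_def)
        qed
        ultimately have "hausdorff_measure w (heavy_part K e) = 0"
          by (rule hausdorff_measure_zero_mono)
        then have "hausdorff_dim (heavy_part K e) \<le> ereal w"
          using w by (intro hausdorff_dim_le) auto
        then show False using e by simp
      qed
    qed
    ultimately show "hausdorff_measure 1 {e \<in> sphere 0 1. \<not> hausdorff_dim (heavy_part K e) \<le> ereal w} = 0"
      by (rule hausdorff_measure_zero_mono)
  qed
  then show "heavy_dim K \<le> 1" by (simp add: heavy_dim_def one_ereal_def)
qed

end
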